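(* Let $n\ge 2$ be an integer. The value of the tree series $\mathcal{S}$ at $x=[-n]_q$, in which $q$ is then replaced by $1/q$, is the tree series $-q\,\Sigma_{-q}G^{(n-2)}$.
   Context: $q$ and $x$ are indeterminates; $[m]_q=\frac{q^m-1}{q-1}$ for every $m\in\mathbb{Z}$. A tree is a finite rooted tree (finite connected acyclic graph with a distinguished vertex, the root), considered up to isomorphism. $\#T$ is the number of vertices of $T$, $\mathrm{aut}(T)$ is the order of its automorphism group, and $\bullet$ is the one-vertex tree. A tree series over a commutative $\mathbb{Q}$-algebra $R$ is a formal infinite sum $A=\sum_T A_T\,\frac{T}{\mathrm{aut}(T)}$ over all trees, with $A_T\in R$; $\bullet$ is also viewed as a tree series. Substitutions in a tree series are made coefficient by coefficient. For $\alpha\in R$, $(\Sigma_\alpha A)_T=\alpha^{\#T-1}A_T$. For tree series $A,B$, the tree series $\mathrm{Crls}\diamond(A,B)$ is defined by $$(\mathrm{Crls}\diamond(A,B))_T=\sum_{T_0}A_{T_0}\prod_{T'}B_{T'},$$ where $T_0$ runs over the subtrees (connected sets of vertices) of $T$ containing the root of $T$ (and rooted there), and $T'$ runs over the connected components of the complement of $T_0$ in $T$, each rooted at its vertex closest to the root of $T$ (an empty product is $1$). $\mathcal{S}$ denotes the unique tree series over $\mathbb{Q}(q)[x]$ satisfying $$q\,\Sigma_q \mathcal{S}-\mathrm{Crls}\diamond(\mathcal{S},-\bullet)=q\,(1+(q-1)x)\,\mathrm{Crls}\diamond(\bullet,\,q\,\Sigma_q \mathcal{S})-\bullet .$$ Order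 the vertices of a tree $T$ by the natural partial order $\le$ for which the root is the minimum ($u\le v$ iff $u$ lies on the path from $v$ to the root). A strictly decreasing $m$-colouring of $T$ is a map $c$ from the vertices of $T$ to $\{0,\dots,m\}$ that is strictly decreasing: $u<v$ implies $c(u)>c(v)$. $\sigma(c)$ is the sum of the values $c(v)$ over all vertices $v$. $G^{(m)}=\sum_T G^{(m)}_T\frac{T}{\mathrm{aut}(T)}$ with $G_T^{(m)}=\sum_c q^{\sigma(c)}$, the sum over strictly decreasing $m$-colourings of $T$. *)

theory Defs
  imports
    "HOL-Computational_Algebra.Computational_Algebra"
    "HOL-Computational_Algebra.Field_as_Ring"
    "HOL-Library.FuncSet"
begin

section \<open>Finite rooted trees\<close>

text \<open>A simple graph is given by its vertex set and its adjacency relation, which is symmetric and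
  irreflexive.\<close>

datatype 'v rgraph = RGraph (verts: "'v set") (adj: "'v rel") (root: 'v)

definition connected_in :: "'v rel \<Rightarrow> 'v set \<Rightarrow> bool" where
  "connected_in E X \<longleftrightarrow> (\<forall>u\<in>X. \<forall>v\<in>X. (u, v) \<in> (Restr E X)\<^sup>*)"

definition graph_cycle :: "'v rel \<Rightarrow> 'v list \<Rightarrow> bool" where
  "graph_cycle E p \<longleftrightarrow> length p \<ge> 3 \<and> distinct p \<and>
     successively (\<lambda>u v. (u, v) \<in> E) p \<and> (last p, hd p) \<in> E"

definition rooted_tree :: "'v rgraph \<Rightarrow> bool" where
  "rooted_tree t \<longleftrightarrow> finite (verts t) \<and> root t \<in> verts t \<and>
     adj t \<subseteq> verts t \<times> verts t \<and> sym (adj t) \<and> irrefl (adj t) \<and>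
     connected_in (adj t) (verts t) \<and> (\<nexists>p. graph_cycle (adj t) p)"

definition rooted_iso :: "'v rgraph \<Rightarrow> 'w rgraph \<Rightarrow> bool" where
  "rooted_iso s t \<longleftrightarrow> (\<exists>f. bij_betw f (verts s) (verts t) \<and> f (root s) = root t \<and>
     (\<forall>u\<in>verts s. \<forall>v\<in>verts s. (u, v) \<in> adj s \<longleftrightarrow> (f u, f v) \<in> adj t))"

definition induced :: "'v rgraph \<Rightarrow> 'v set \<Rightarrow> 'v \<Rightarrow> 'v rgraph" where
  "induced t X r = RGraph X (Restr (adj t) X) r"

definition components :: "'v rel \<Rightarrow> 'v set \<Rightarrow> 'v set set" where
  "components E X = (\<lambda>u. (Restr E X)\<^sup>* `` {u}) ` X"

definition root_dist :: "'v rgraph \<Rightarrow> 'v \<Rightarrow> nat" where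
  "root_dist t v = (LEAST k. (root t, v) \<in> adj t ^^ k)"

definition closest :: "'v rgraph \<Rightarrow> 'v set \<Rightarrow> 'v" where
  "closest t C = arg_min_on (root_dist t) C"

text \<open>In a tree the path from \<open>v\<close> to the root is unique, so it makes no difference
  whether it is quantified existentially or universally here.\<close>

definition tree_le :: "'v rgraph \<Rightarrow> 'v \<Rightarrow> 'v \<Rightarrow> bool" where
  "tree_le t u v \<longleftrightarrow> (\<exists>p. p \<noteq> [] \<and> set p \<subseteq> verts t \<and> distinct p \<and>
     successively (\<lambda>a b. (a, b) \<in> adj t) p \<and> hd p = v \<and> last p = root t \<and> u \<in> set p)"

definition tree_less :: "'v rgraph \<Rightarrow> 'v \<Rightarrow> 'v \<Rightarrow> bool" where
  "tree_less t u v \<longleftrightarrow> tree_le t u v \<and> u \<noteq> v"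

section \<open>Isomorphism classes of finite rooted trees\<close>

lemma rooted_iso_refl: "rooted_iso t t"
  unfolding rooted_iso_def by (rule exI[of _ id]) auto

lemma rooted_iso_sym:
  assumes "rooted_iso s t" "rooted_tree s"
  shows "rooted_iso t s"
proof -
  obtain f where f: "bij_betw f (verts s) (verts t)" "f (root s) = root t"
    "\<forall>u\<in>verts s. \<forall>v\<in>verts s. (u, v) \<in> adj s \<longleftrightarrow> (f u, f v) \<in> adj t"
    using assms(1) unfolding rooted_iso_def by blast
  define g where "g = the_inv_into (verts s) f"
  have inj: "inj_on f (verts s)" and im: "f ` verts s = verts t"
    using f(1) by (auto simp: bij_betw_def)
  have gf: "g (f v) = v" if "v \<in> verts s" for v
    using that inj by (simp add: g_def the_inv_into_f_f)
  have "bij_betw g (verts t) (verts s)"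
    using f(1) by (simp add: g_def bij_betw_the_inv_into)
  moreover have "g (root t) = root s"
    using gf[of "root s"] f(2) assms(2) by (simp add: rooted_tree_def)
  moreover have "(u, v) \<in> adj t \<longleftrightarrow> (g u, g v) \<in> adj s" if "u \<in> verts t" "v \<in> verts t" for u v
  proof -
    have "u \<in> f ` verts s" "v \<in> f ` verts s"
      using that im by simp_all
    then obtain a b where ab: "a \<in> verts s" "b \<in> verts s" "u = f a" "v = f b"
      by (elim imageE)
    have "(a, b) \<in> adj s \<longleftrightarrow> (f a, f b) \<in> adj t"
      using f(3) ab(1,2) by blast
    then show ?thesis by (simp add: ab(3,4) gf[OF ab(1)] gf[OF ab(2)])
  qed
  ultimately show ?thesis unfolding rooted_iso_def by blast
qed

lemma rooted_iso_trans:
  assumes "rooted_iso s t" "rooted_iso t u"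
  shows "rooted_iso s u"
proof -
  obtain f where f: "bij_betw f (verts s) (verts t)" "f (root s) = root t"
    "\<forall>u\<in>verts s. \<forall>v\<in>verts s. (u, v) \<in> adj s \<longleftrightarrow> (f u, f v) \<in> adj t"
    using assms(1) unfolding rooted_iso_def by blast
  obtain g where g: "bij_betw g (verts t) (verts u)" "g (root t) = root u"
    "\<forall>a\<in>verts t. \<forall>b\<in>verts t. (a, b) \<in> adj t \<longleftrightarrow> (g a, g b) \<in> adj u"
    using assms(2) unfolding rooted_iso_def by blast
  have "bij_betw (g \<circ> f) (verts s) (verts u)"
    using f(1) g(1) by (rule bij_betw_trans)
  moreover have "(g \<circ> f) (root s) = root u" using f(2) g(2) by simp
  moreover have "(a, b) \<in> adj s \<longleftrightarrow> ((g \<circ> f) a, (g \<circ> f) b) \<in> adj u"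
    if "a \<in> verts s" "b \<in> verts s" for a b
  proof -
    have "f a \<in> verts t" "f b \<in> verts t"
      using that f(1) by (auto simp: bij_betw_def)
    then show ?thesis using f(3) g(3) that by (metis comp_apply)
  qed
  ultimately show ?thesis unfolding rooted_iso_def by blast
qed

definition same_tree :: "nat rgraph \<Rightarrow> nat rgraph \<Rightarrow> bool" where
  "same_tree s t \<longleftrightarrow> rooted_tree s \<and> rooted_tree t \<and> rooted_iso s t"

lemma rooted_tree_singleton: "rooted_tree (RGraph {v} {} v)"
proof -
  have "\<not> graph_cycle {} p" for p :: "'a list"
    by (simp add: graph_cycle_def)
  then show ?thesis
    by (simp add: rooted_tree_def connected_in_def sym_def irrefl_def)
qed

text \<open>Every finite rooted tree is isomorphic to one whose vertices are natural numbers, so this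
  partial quotient is the set of all isomorphism classes of finite rooted trees.\<close>

quotient_type tree = "nat rgraph" / partial: same_tree
proof (rule part_equivpI)
  have "same_tree (RGraph {0} {} 0) (RGraph {0} {} 0)"
    by (simp add: same_tree_def rooted_tree_singleton rooted_iso_refl)
  then show "\<exists>t. same_tree t t" ..
  show "symp same_tree"
    by (rule sympI) (simp add: same_tree_def rooted_iso_sym)
  show "transp same_tree"
    by (rule transpI) (meson same_tree_def rooted_iso_trans)
qed

definition tree_size :: "tree \<Rightarrow> nat" where
  "tree_size T = card (verts (rep_tree T))"

definition bullet :: tree where
  "bullet = abs_tree (RGraph {0} {} 0)"

section \<open>Tree series\<close>

text \<open>The series \<open>\<Sum>T. A\<^sub>T T / aut T\<close> is represented by the function taking \<open>T\<close> to
  \<open>A\<^sub>T\<close>. All operations below, and equality, are given on these normalised coefficients.\<close>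

type_synonym 'r tree_series = "tree \<Rightarrow> 'r"

text \<open>The one-vertex tree has only one automorphism, hence coefficient 1.\<close>

definition bullet_series :: "'r::comm_ring_1 tree_series" where
  "bullet_series T = (if T = bullet then 1 else 0)"

definition Sigma_series :: "'r::comm_ring_1 \<Rightarrow> 'r tree_series \<Rightarrow> 'r tree_series" where
  "Sigma_series \<alpha> A T = \<alpha> ^ (tree_size T - 1) * A T"

definition root_subtrees :: "'v rgraph \<Rightarrow> 'v set set" where
  "root_subtrees t = {X. X \<subseteq> verts t \<and> root t \<in> X \<and> connected_in (adj t) X}"

definition Crls_diamond :: "'r::comm_ring_1 tree_series \<Rightarrow> 'r tree_series \<Rightarrow> 'r tree_series" where
  "Crls_diamond A B T = (let t = rep_tree T in
     \<Sum>X\<in>root_subtrees t. A (abs_tree (induced t X (root t))) *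
       (\<Prod>C\<in>components (adj t) (verts t - X). B (abs_tree (induced t C (closest t C)))))"

section \<open>The field of rational functions in \<open>q\<close>\<close>

type_synonym ratq = "rat poly fract"

definition q_var :: ratq where
  "q_var = to_fract [:0, 1:]"

definition q_int :: "int \<Rightarrow> ratq" where
  "q_int m = (q_var powi m - 1) / (q_var - 1)"

definition eval_q :: "rat poly \<Rightarrow> ratq \<Rightarrow> ratq" where
  "eval_q p y = poly (map_poly (\<lambda>c. to_fract [:c:]) p) y"

text \<open>Substitution of \<open>y\<close> for \<open>q\<close> in a rational function; it is meaningful when the denominator
  of \<open>f\<close> does not vanish at \<open>y\<close>, as is always the case for \<open>y = 1 / q\<close>.\<close>

definition subst_q :: "ratq \<Rightarrow> ratq \<Rightarrow> ratq" where
  "subst_q y f = eval_q (fst (quot_of_fract f)) y / eval_q (snd (quot_of_fract f)) y"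

section \<open>The two tree series\<close>

definition S_equation :: "ratq poly tree_series \<Rightarrow> bool" where
  "S_equation S \<longleftrightarrow> (let q = [:q_var:]; x = [:0, 1:] in
     (\<lambda>T. q * Sigma_series q S T - Crls_diamond S (\<lambda>T'. - bullet_series T') T) =
     (\<lambda>T. q * (1 + (q - 1) * x) * Crls_diamond bullet_series (\<lambda>T'. q * Sigma_series q S T') T
            - bullet_series T))"

definition S_series :: "ratq poly tree_series" where
  "S_series = (THE S. S_equation S)"

definition colourings :: "nat \<Rightarrow> 'v rgraph \<Rightarrow> ('v \<Rightarrow> nat) set" where
  "colourings m t = {c \<in> verts t \<rightarrow>\<^sub>E {0..m}.
     \<forall>u\<in>verts t. \<forall>v\<in>verts t. tree_less t u v \<longrightarrow> c u > c v}"

definition G_series :: "nat \<Rightarrow> ratq tree_series" where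
  "G_series m T = (let t = rep_tree T in
     \<Sum>c\<in>colourings m t. q_var ^ (\<Sum>v\<in>verts t. c v))"

end

(* Replacing q by 1/q and putting x = [-n]_q turns the equation of S into a recursion that determines
   each coefficient from smaller trees, because the leading factor q^(-#T) - 1 never vanishes.
   With m = n - 2, the claim becomes
     G^(m)_T + q^(m+1) prod_C G^(m)_C = sum_X q^(#X) G^(m)_X + [T = one vertex],
   where C runs over the branches at the root and X over the root subtrees whose complement is
   a set of leaves. Both sides count strictly decreasing (m+1)-colourings of T: the left one
   according to whether the root, which carries the largest colour, has colour m+1 or not; the
   right one according to the set of vertices of nonzero colour. *)
theory Submission
  imports Defs
begin

section \<open>Simple paths in trees\<close>

text \<open>The statement concerns isomorphism classes, whereas root subtrees and branches are
  vertex sets inside one representative. Colours are therefore counted for an arbitrary relation on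
  a vertex set, and the order on a root subtree or a branch is compared with that of the whole tree
  through uniqueness of simple paths. The constant q^(m+1) is the image of q (1 + (q-1) x): at x =
  [-n]_q the bracket is q^(-n), and q * q^(-n) becomes q^(n-1) under q -> 1/q. The second argument
  -bullet gives a sign for each removed leaf; the factor (-q)^#T in the claimed series absorbs these
  signs and cancels the powers of 1/q, which leaves an identity between counts. Two points of
  algebra need care. S is a definite description over Q(q)[x], so its existence requires q^k - 1 to
  be invertible there; and replacing q by 1/q is a ring homomorphism of Q(q) only because no nonzero
  polynomial vanishes at 1/q.\<close>

definition spath :: "'v rel \<Rightarrow> 'v set \<Rightarrow> 'v list \<Rightarrow> 'v \<Rightarrow> 'v \<Rightarrow> bool" where
  "spath E X p u v \<longleftrightarrow> p \<noteq> [] \<and> set p \<subseteq> X \<and> distinct p \<and>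
     successively (\<lambda>a b. (a, b) \<in> E) p \<and> hd p = u \<and> last p = v"

lemma spath_mono: "spath E X p u v \<Longrightarrow> X \<subseteq> Y \<Longrightarrow> spath E Y p u v"
  by (auto simp: spath_def)

lemma spath_hd_in: "spath E X p u v \<Longrightarrow> u \<in> set p"
  and spath_last_in: "spath E X p u v \<Longrightarrow> v \<in> set p"
  by (auto simp: spath_def)

lemma spath_Cons:
  assumes "spath E X p u v" "a \<in> X" "a \<notin> set p" "(a, u) \<in> E"
  shows "spath E X (a # p) a v"
  using assms by (auto simp: spath_def successively_Cons)

lemma spath_snoc:
  assumes "spath E X p u v" "a \<in> X" "a \<notin> set p" "(v, a) \<in> E"
  shows "spath E X (p @ [a]) u a"
  using assms by (auto simp: spath_def successively_append_iff)

text \<open>Loops of a walk are cut off: when the new first vertex already lies on the path, only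
  the part starting at that vertex is kept.\<close>

lemma spath_exists:
  assumes "(u, v) \<in> (Restr E X)\<^sup>*" "v \<in> X"
  shows "\<exists>p. spath E X p u v"
  using assms
proof (induction rule: converse_rtrancl_induct)
  case base
  then have "spath E X [v] v v" by (simp add: spath_def)
  then show ?case ..
next
  case (step a c)
  then obtain p where p: "spath E X p c v" by blast
  show ?case
  proof (cases "a \<in> set p")
    case True
    then obtain xs ys where "p = xs @ a # ys" by (auto dest: split_list)
    with p have "spath E X (a # ys) a v"
      by (auto simp: spath_def successively_append_iff)
    then show ?thesis ..
  next
    case False
    then have "spath E X (a # p) a v"
      using p step.hyps(1) by (intro spath_Cons) auto
    then show ?thesis ..
  qed
qed

lemma successively_rtrancl:
  assumes "successively (\<lambda>a b. (a, b) \<in> E) p" "set p \<subseteq> X" "a \<in> set p"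
  shows "(hd p, a) \<in> (Restr E X)\<^sup>*"
  using assms
proof (induction p)
  case (Cons b p)
  show ?case
  proof (cases "a = b")
    case False
    then have a: "a \<in> set p" using Cons.prems(3) by simp
    then have "p \<noteq> []" by auto
    then have "(b, hd p) \<in> Restr E X" using Cons.prems by (auto simp: successively_Cons)
    moreover have "(hd p, a) \<in> (Restr E X)\<^sup>*"
      using Cons a by (auto simp: successively_Cons)
    ultimately show ?thesis unfolding list.sel by (rule converse_rtrancl_into_rtrancl)
  qed simp
qed simp

lemma sym_rtrancl_Restr: "sym E \<Longrightarrow> sym ((Restr E X)\<^sup>*)"
  by (rule sym_rtrancl) (auto simp: sym_def)

lemma spath_rtrancl:
  assumes "spath E X p u v" "sym E" "a \<in> set p" "b \<in> set p"
  shows "(a, b) \<in> (Restr E X)\<^sup>*"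
proof -
  have "(u, a) \<in> (Restr E X)\<^sup>*" "(u, b) \<in> (Restr E X)\<^sup>*"
    using successively_rtrancl[of E p X] assms by (auto simp: spath_def)
  then show ?thesis
    using sym_rtrancl_Restr[OF assms(2)] by (meson rtrancl_trans symD)
qed

text \<open>If two paths part right after \<open>u\<close>, their tails avoid \<open>u\<close> and
  meet in \<open>v\<close>; a simple path avoiding \<open>u\<close> between the two second vertices
  then closes up through \<open>u\<close> to a cycle. The ambient sets \<open>X\<close> and
  \<open>Y\<close> may differ, so a path inside a subtree can be identified with one in the whole
  tree.\<close>

lemma spath_unique:
  assumes "\<nexists>p. graph_cycle E p" "sym E"
    and "spath E X p u v" "spath E Y p' u v"
  shows "p = p'"
  using assms(3,4)
proof (induction p arbitrary: u p' X Y)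
  case Nil
  then show ?case by (simp add: spath_def)
next
  case (Cons a ps)
  have a: "a = u" using Cons.prems by (simp add: spath_def)
  obtain ps' where p': "p' = u # ps'" using Cons.prems(2)
    by (cases p') (auto simp: spath_def)
  show ?case
  proof (cases "ps = [] \<or> ps' = []")
    case True
    then have "v = u" using Cons.prems a p' by (auto simp: spath_def)
    then have "ps = []" "ps' = []"
      using Cons.prems a p' by (auto simp: spath_def split: if_splits dest: last_in_set)
    then show ?thesis using a p' by simp
  next
    case False
    then have ps: "spath E (- {u}) ps (hd ps) v" "(u, hd ps) \<in> E"
      and ps': "spath E (- {u}) ps' (hd ps') v" "(u, hd ps') \<in> E"
      using Cons.prems a p' by (auto simp: spath_def successively_Cons)
    show ?thesis
    proof (cases "hd ps = hd ps'")
      case True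
      then show ?thesis using Cons.IH[OF ps(1)] ps' a p' by auto
    next
      case neq: False
      have "(hd ps, v) \<in> (Restr E (- {u}))\<^sup>*" "(v, hd ps') \<in> (Restr E (- {u}))\<^sup>*"
        using spath_rtrancl ps(1) ps'(1) assms(2) spath_hd_in spath_last_in by metis+
      then have "(hd ps, hd ps') \<in> (Restr E (- {u}))\<^sup>*" by simp
      moreover have "hd ps' \<in> - {u}"
        using spath_hd_in[OF ps'(1)] ps'(1) by (auto simp: spath_def)
      ultimately obtain r where r: "spath E (- {u}) r (hd ps) (hd ps')"
        using spath_exists by metis
      \<comment> \<open>The endpoints of \<open>r\<close> differ, so \<open>r\<close> has two
        vertices at least and \<open>u # r\<close> reaches the length 3 demanded by
        \<open>graph_cycle\<close>.\<close>
      have "length r \<ge> 2"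
        using r neq by (cases r; cases "tl r") (auto simp: spath_def)
      moreover have "distinct (u # r)" using r by (auto simp: spath_def)
      moreover have "successively (\<lambda>a b. (a, b) \<in> E) (u # r)"
        using r ps(2) by (auto simp: spath_def successively_Cons)
      moreover have "(last (u # r), hd (u # r)) \<in> E"
        using r symD[OF assms(2) ps'(2)] by (auto simp: spath_def)
      ultimately have "graph_cycle E (u # r)" by (simp add: graph_cycle_def)
      then show ?thesis using assms(1) by blast
    qed
  qed
qed

section \<open>The tree order in terms of paths to the root\<close>

lemma tree_le_iff_spath:
  "tree_le t u v \<longleftrightarrow> (\<exists>p. spath (adj t) (verts t) p v (root t) \<and> u \<in> set p)"
  by (auto simp: tree_le_def spath_def)

lemma spath_Restr: "spath (Restr E X) X p u v \<longleftrightarrow> spath E X p u v"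
proof -
  have "successively (\<lambda>a b. (a, b) \<in> Restr E X) p \<longleftrightarrow> successively (\<lambda>a b. (a, b) \<in> E) p"
    if "set p \<subseteq> X"
    using that by (intro successively_cong) auto
  then show ?thesis by (auto simp: spath_def)
qed

lemma induced_sel [simp]:
  "verts (induced t X r) = X" "adj (induced t X r) = Restr (adj t) X" "root (induced t X r) = r"
  by (simp_all add: induced_def)

lemma tree_le_induced_iff:
  "tree_le (induced t X r) u v \<longleftrightarrow> (\<exists>p. spath (adj t) X p v r \<and> u \<in> set p)"
  by (simp add: tree_le_iff_spath spath_Restr)

lemma rooted_treeD:
  assumes "rooted_tree t"
  shows "finite (verts t)" "root t \<in> verts t" "adj t \<subseteq> verts t \<times> verts t" "sym (adj t)"
    "irrefl (adj t)" "connected_in (adj t) (verts t)" "\<nexists>p. graph_cycle (adj t) p"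
  using assms by (simp_all add: rooted_tree_def)

lemma rooted_tree_spath:
  assumes "rooted_tree t" "v \<in> verts t"
  obtains p where "spath (adj t) (verts t) p v (root t)"
  using rooted_treeD[OF assms(1)] assms(2) spath_exists[of v "root t" "adj t" "verts t"]
  unfolding connected_in_def by blast

lemma rooted_tree_spath_unique:
  assumes "rooted_tree t" "spath (adj t) X p u v" "spath (adj t) Y p' u v"
  shows "p = p'"
  using spath_unique[OF _ _ assms(2,3)] rooted_treeD[OF assms(1)] by blast

lemma tree_le_iff_mem_spath:
  assumes "rooted_tree t" "spath (adj t) (verts t) p v (root t)"
  shows "tree_le t u v \<longleftrightarrow> u \<in> set p"
  using assms rooted_tree_spath_unique tree_le_iff_spath by metis

lemma connected_in_Restr: "connected_in (Restr E X) X \<longleftrightarrow> connected_in E X"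
  by (simp add: connected_in_def Int_assoc)

lemma rooted_tree_induced:
  assumes "rooted_tree t" "X \<subseteq> verts t" "connected_in (adj t) X" "r \<in> X"
  shows "rooted_tree (induced t X r)"
proof -
  note t = rooted_treeD[OF assms(1)]
  have "graph_cycle (adj t) p" if "graph_cycle (Restr (adj t) X) p" for p
    using that unfolding graph_cycle_def by (auto elim: successively_mono)
  then show ?thesis
    using t assms(2-) finite_subset[OF assms(2) t(1)]
    by (auto simp: rooted_tree_def connected_in_Restr sym_def irrefl_def)
qed

lemma root_le:
  assumes "rooted_tree t" "v \<in> verts t"
  shows "tree_le t (root t) v"
  using assms rooted_tree_spath spath_last_in tree_le_iff_spath by metis

text \<open>The path from \<open>a\<close> to the root either passes through \<open>b\<close>, or
  becomes a path from \<open>b\<close> through \<open>a\<close> when \<open>b\<close> is put in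
  front.\<close>

lemma adj_comparable:
  assumes "rooted_tree t" "(a, b) \<in> adj t"
  shows "tree_less t a b \<or> tree_less t b a"
proof -
  note t = rooted_treeD[OF assms(1)]
  have ab: "a \<in> verts t" "b \<in> verts t" "a \<noteq> b"
    using t(3,5) assms(2) by (auto simp: irrefl_def)
  obtain p where p: "spath (adj t) (verts t) p a (root t)"
    using rooted_tree_spath[OF assms(1) ab(1)] .
  have "tree_le t b a \<or> tree_le t a b"
  proof (cases "b \<in> set p")
    case False
    then have "spath (adj t) (verts t) (b # p) b (root t)"
      using p ab symD[OF t(4) assms(2)] by (intro spath_Cons)
    then show ?thesis using tree_le_iff_spath spath_hd_in[OF p] by (metis list.set_intros(2))
  qed (use p tree_le_iff_spath in metis)
  then show ?thesis using ab(3) by (auto simp: tree_less_def)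
qed

lemma root_subtree_spath:
  assumes "rooted_tree t" "X \<in> root_subtrees t" "v \<in> X"
  obtains p where "spath (adj t) X p v (root t)"
proof -
  have "(v, root t) \<in> (Restr (adj t) X)\<^sup>*" "root t \<in> X"
    using assms(2,3) by (auto simp: root_subtrees_def connected_in_def)
  then show thesis using spath_exists that by metis
qed

text \<open>The path from \<open>v\<close> to the root inside \<open>X\<close> is the only one in
  \<open>t\<close>, so the subtree inherits the order of \<open>t\<close>.\<close>

lemma tree_le_root_subtree:
  assumes "rooted_tree t" "X \<in> root_subtrees t" "v \<in> X"
  shows "tree_le (induced t X (root t)) u v \<longleftrightarrow> tree_le t u v"
proof -
  obtain p where p: "spath (adj t) X p v (root t)"
    using root_subtree_spath[OF assms] .
  have "spath (adj t) (verts t) p v (root t)"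
    using p by (rule spath_mono) (use assms(2) in \<open>auto simp: root_subtrees_def\<close>)
  then have "tree_le t u v \<longleftrightarrow> u \<in> set p" by (rule tree_le_iff_mem_spath[OF assms(1)])
  moreover have "tree_le (induced t X (root t)) u v \<longleftrightarrow> u \<in> set p"
    using p rooted_tree_spath_unique[OF assms(1)] by (metis tree_le_induced_iff)
  ultimately show ?thesis by simp
qed

lemma root_subtree_down_closed:
  assumes "rooted_tree t" "X \<in> root_subtrees t" "v \<in> X" "tree_le t u v"
  shows "u \<in> X"
  using assms(4) unfolding tree_le_root_subtree[OF assms(1-3), symmetric] tree_le_induced_iff
  by (auto simp: spath_def)

section \<open>Connected components\<close>

lemma components_Union: "\<Union> (components E X) = X"
proof -
  have "v \<in> X" if "u \<in> X" "(u, v) \<in> (Restr E X)\<^sup>*" for u v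
    using that(2,1) by (induction rule: rtrancl_induct) auto
  then show ?thesis by (auto simp: components_def)
qed

lemma components_nonempty: "C \<in> components E X \<Longrightarrow> C \<noteq> {}"
  by (auto simp: components_def)

lemma components_eq_class:
  assumes "sym E" "C \<in> components E X" "u \<in> C"
  shows "C = (Restr E X)\<^sup>* `` {u}"
proof -
  obtain w where "C = (Restr E X)\<^sup>* `` {w}" using assms(2) by (auto simp: components_def)
  then show ?thesis
    using assms(3) sym_rtrancl_Restr[OF assms(1), of X]
    by (auto intro: rtrancl_trans dest: symD)
qed

lemma components_disjoint:
  assumes "sym E" "C \<in> components E X" "D \<in> components E X" "C \<noteq> D"
  shows "C \<inter> D = {}"
  using components_eq_class[OF assms(1)] assms(2-) by (metis disjoint_iff)

lemma rtrancl_Restr_class: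
  assumes "(u, v) \<in> (Restr E X)\<^sup>*"
  shows "(u, v) \<in> (Restr E ((Restr E X)\<^sup>* `` {u}))\<^sup>*"
  using assms
proof (induction rule: rtrancl_induct)
  case (step y z)
  have "(u, z) \<in> (Restr E X)\<^sup>*" using step.hyps by (rule rtrancl_into_rtrancl)
  then have "(y, z) \<in> Restr E ((Restr E X)\<^sup>* `` {u})" using step by auto
  with step.IH show ?case by (rule rtrancl_into_rtrancl)
qed simp

lemma components_connected:
  assumes "sym E" "C \<in> components E X"
  shows "connected_in E C"
  unfolding connected_in_def
proof (intro ballI)
  fix u v assume "u \<in> C" "v \<in> C"
  then show "(u, v) \<in> (Restr E C)\<^sup>*"
    using components_eq_class[OF assms \<open>u \<in> C\<close>] rtrancl_Restr_class[of u v E X] by auto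
qed

lemma finite_components: "finite X \<Longrightarrow> finite (components E X)"
  by (simp add: components_def)

lemma components_subset: "C \<in> components E X \<Longrightarrow> C \<subseteq> X"
  using components_Union[of E X] by blast

text \<open>For the complement of a root subtree, which contains all descendants of its vertices,
  absence of edges means that only leaves of the tree were removed.\<close>

definition independent_in :: "'v rel \<Rightarrow> 'v set \<Rightarrow> bool" where
  "independent_in E X \<longleftrightarrow> Restr E X = {}"

lemma components_independent:
  assumes "independent_in E X"
  shows "components E X = (\<lambda>u. {u}) ` X"
  using assms by (auto simp: components_def independent_in_def)

lemma components_not_independent:
  assumes "\<not> independent_in E X" "irrefl E"
  obtains C where "C \<in> components E X" "card C \<noteq> 1"
proof -
  obtain a b where ab: "a \<in> X" "b \<in> X" "(a, b) \<in> E"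
    using assms(1) by (auto simp: independent_in_def)
  let ?C = "(Restr E X)\<^sup>* `` {a}"
  have "?C \<in> components E X" using ab by (auto simp: components_def)
  moreover have "{a, b} \<subseteq> ?C" "a \<noteq> b"
    using ab assms(2) by (auto intro: r_into_rtrancl simp: irrefl_def)
  then have "card ?C \<noteq> 1"
    unfolding card_1_singleton_iff One_nat_def by (metis insert_subset singletonD)
  ultimately show thesis using that by blast
qed

lemma closest_in:
  assumes "rooted_tree t" "X \<subseteq> verts t" "C \<in> components (adj t) X"
  shows "closest t C \<in> C"
  unfolding closest_def
  using assms components_nonempty[OF assms(3)] components_subset[OF assms(3)]
    finite_subset[OF _ rooted_treeD(1)[OF assms(1)]]
  by (intro arg_min_if_finite(1)) auto

lemma rooted_tree_component:
  assumes "rooted_tree t" "X \<subseteq> verts t" "C \<in> components (adj t) X"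
  shows "rooted_tree (induced t C (closest t C))"
  using assms components_subset[OF assms(3)] closest_in[OF assms]
    components_connected[OF rooted_treeD(4)[OF assms(1)] assms(3)]
  by (intro rooted_tree_induced) auto

lemma root_dist_adj:
  assumes "rooted_tree t" "v \<in> verts t"
  shows "(root t, v) \<in> adj t ^^ root_dist t v"
proof -
  have "(root t, v) \<in> (Restr (adj t) (verts t))\<^sup>*"
    using rooted_treeD[OF assms(1)] assms(2) by (auto simp: connected_in_def)
  then have "(root t, v) \<in> (adj t)\<^sup>*" by (rule rev_subsetD) (rule rtrancl_mono, blast)
  then obtain k where "(root t, v) \<in> adj t ^^ k" by (auto simp: rtrancl_power)
  then show ?thesis unfolding root_dist_def by (rule LeastI)
qed

text \<open>On the path from a vertex of \<open>C\<close> to the root, everything before the root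
  stays in \<open>C\<close>, so \<open>C\<close> contains a neighbour of the root. The minimiser of
  \<open>root_dist\<close> on \<open>C\<close> thus has distance at most 1, and distance 0 would
  make it the root itself.\<close>

lemma closest_adj_root:
  assumes t: "rooted_tree t" and C: "C \<in> components (adj t) (verts t - {root t})"
  shows "(root t, closest t C) \<in> adj t"
proof -
  note t' = rooted_treeD[OF t]
  have CV: "C \<subseteq> verts t - {root t}" using components_subset[OF C] .
  obtain v where v: "v \<in> C" using components_nonempty[OF C] by blast
  then obtain p where p: "spath (adj t) (verts t) p v (root t)"
    using rooted_tree_spath[OF t] CV by blast
  define p' where "p' = butlast p"
  have pe: "p = p' @ [root t]" using p by (simp add: p'_def spath_def) (metis append_butlast_last_id)
  have "p' \<noteq> []" using p pe v CV by (auto simp: spath_def)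
  then have p': "spath (adj t) (verts t - {root t}) p' v (last p')" and w: "(last p', root t) \<in> adj t"
    using p unfolding pe by (auto simp: spath_def successively_append_iff)
  have "(v, last p') \<in> (Restr (adj t) (verts t - {root t}))\<^sup>*"
    using spath_rtrancl[OF p' t'(4)] spath_hd_in[OF p'] spath_last_in[OF p'] by blast
  then have wC: "last p' \<in> C" using components_eq_class[OF t'(4) C v] by blast
  have "finite C" using CV t'(1) finite_subset by blast
  then have "root_dist t (closest t C) \<le> root_dist t (last p')"
    unfolding closest_def using arg_min_least wC by (metis empty_iff)
  also have "\<dots> \<le> 1" unfolding root_dist_def
    by (rule Least_le) (use symD[OF t'(4) w] in simp)
  finally have le: "root_dist t (closest t C) \<le> 1" .
  have cl: "closest t C \<in> verts t - {root t}"
    using closest_in[OF t _ C] CV by auto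
  have rel: "(root t, closest t C) \<in> adj t ^^ root_dist t (closest t C)"
    using root_dist_adj[OF t] cl by simp
  then have "root_dist t (closest t C) \<noteq> 0"
    using cl by (metis DiffD2 pair_in_Id_conv relpow.simps(1) singletonI)
  then have "root_dist t (closest t C) = 1" using le by linarith
  then show ?thesis using rel by simp
qed

text \<open>The path from \<open>v\<close> to the root of \<open>t\<close> is the path inside the
  branch \<open>C\<close> to its own root, followed by one more vertex, the root of
  \<open>t\<close>.\<close>

lemma tree_le_component:
  assumes t: "rooted_tree t" and C: "C \<in> components (adj t) (verts t - {root t})" and v: "v \<in> C"
  shows "tree_le t u v \<longleftrightarrow> u = root t \<or> tree_le (induced t C (closest t C)) u v"
proof -
  note t' = rooted_treeD[OF t]
  let ?r = "closest t C"
  have CV: "C \<subseteq> verts t - {root t}" using components_subset[OF C] .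
  have rC: "?r \<in> C" using closest_in[OF t _ C] by auto
  then have "(v, ?r) \<in> (Restr (adj t) C)\<^sup>*"
    using components_connected[OF t'(4) C] v by (auto simp: connected_in_def)
  then obtain p where p: "spath (adj t) C p v ?r" using spath_exists rC by metis
  then have "spath (adj t) (verts t) (p @ [root t]) v (root t)"
    using symD[OF t'(4) closest_adj_root[OF t C]] CV t'(2) spath_mono[OF p, of "verts t"]
    by (intro spath_snoc) (auto simp: spath_def)
  then have "tree_le t u v \<longleftrightarrow> u \<in> set (p @ [root t])" by (rule tree_le_iff_mem_spath[OF t])
  moreover have "tree_le (induced t C ?r) u v \<longleftrightarrow> u \<in> set p"
    using p rooted_tree_spath_unique[OF t] by (metis tree_le_induced_iff)
  ultimately show ?thesis by auto
qed

section \<open>Strictly decreasing maps\<close>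

text \<open>A relation on a set replaces the tree, since deleting the root leaves a forest whose
  colourings must be counted as well.\<close>

definition decreasing_maps :: "('v \<Rightarrow> 'v \<Rightarrow> bool) \<Rightarrow> nat \<Rightarrow> 'v set \<Rightarrow> ('v \<Rightarrow> nat) set" where
  "decreasing_maps r m X = {c \<in> X \<rightarrow>\<^sub>E {0..m}. \<forall>u\<in>X. \<forall>v\<in>X. r u v \<longrightarrow> c v < c u}"

definition colouring_sum ::
    "'a::comm_semiring_1 \<Rightarrow> ('v \<Rightarrow> 'v \<Rightarrow> bool) \<Rightarrow> nat \<Rightarrow> 'v set \<Rightarrow> 'a" where
  "colouring_sum q r m X = (\<Sum>c\<in>decreasing_maps r m X. q ^ (\<Sum>v\<in>X. c v))"

lemma finite_decreasing_maps: "finite X \<Longrightarrow> finite (decreasing_maps r m X)"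
  unfolding decreasing_maps_def by (rule finite_subset[of _ "X \<rightarrow>\<^sub>E {0..m}"]) (auto intro: finite_PiE)

lemma decreasing_mapsD:
  assumes "c \<in> decreasing_maps r m X"
  shows "v \<in> X \<Longrightarrow> c v \<le> m" "v \<notin> X \<Longrightarrow> c v = undefined"
    "u \<in> X \<Longrightarrow> v \<in> X \<Longrightarrow> r u v \<Longrightarrow> c v < c u"
  using assms by (auto simp: decreasing_maps_def PiE_def extensional_def)

lemma decreasing_mapsI:
  assumes "\<And>v. v \<in> X \<Longrightarrow> c v \<le> m" "\<And>v. v \<notin> X \<Longrightarrow> c v = undefined"
    "\<And>u v. u \<in> X \<Longrightarrow> v \<in> X \<Longrightarrow> r u v \<Longrightarrow> c v < c u"
  shows "c \<in> decreasing_maps r m X"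
  using assms by (auto simp: decreasing_maps_def PiE_def extensional_def)

text \<open>Colourings are transported along \<open>f\<close> and its inverse, restricted to stay
  extensional. This makes the count independent of the representative of an isomorphism
  class.\<close>

lemma colouring_sum_bij:
  assumes f: "bij_betw f X Y" and r: "\<And>u v. u \<in> X \<Longrightarrow> v \<in> X \<Longrightarrow> r u v \<longleftrightarrow> r' (f u) (f v)"
  shows "colouring_sum q r m X = colouring_sum q r' m Y"
  unfolding colouring_sum_def
proof (rule sum.reindex_bij_witness)
  let ?g = "the_inv_into X f"
  let ?j = "\<lambda>c. restrict (\<lambda>y. c (?g y)) Y" and ?i = "\<lambda>c. restrict (\<lambda>x. c (f x)) X"
  have fX: "f x \<in> Y" "?g (f x) = x" if "x \<in> X" for x
    using f that by (auto simp: bij_betw_def the_inv_into_f_f)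
  have gY: "?g y \<in> X" "f (?g y) = y" if "y \<in> Y" for y
    using f that by (auto simp: bij_betw_def f_the_inv_into_f the_inv_into_into)
  show "?i (?j c) = c" if "c \<in> decreasing_maps r m X" for c
    using decreasing_mapsD(2)[OF that] by (auto simp: fX fun_eq_iff)
  show "?j (?i c) = c" if "c \<in> decreasing_maps r' m Y" for c
    using decreasing_mapsD(2)[OF that] by (auto simp: gY fun_eq_iff)
  show "?j c \<in> decreasing_maps r' m Y" if "c \<in> decreasing_maps r m X" for c
    using decreasing_mapsD[OF that] by (intro decreasing_mapsI) (auto simp: gY r)
  show "?i c \<in> decreasing_maps r m X" if "c \<in> decreasing_maps r' m Y" for c
    using decreasing_mapsD[OF that] by (intro decreasing_mapsI) (auto simp: fX r)
  show "q ^ (\<Sum>v\<in>Y. ?j c v) = q ^ (\<Sum>v\<in>X. c v)" for c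
    using sum.reindex_bij_betw[OF f, of "?j c"] by (auto simp: fX cong: sum.cong)
qed

lemma colouring_sum_cong:
  assumes "\<And>u v. u \<in> X \<Longrightarrow> v \<in> X \<Longrightarrow> r u v \<longleftrightarrow> r' u v"
  shows "colouring_sum q r m X = colouring_sum q r' m X"
  using colouring_sum_bij[of id X X r r'] assms by simp

lemma colouring_sum_empty [simp]: "colouring_sum q r m {} = 1"
  by (simp add: colouring_sum_def decreasing_maps_def)

text \<open>No constraint links \<open>X\<close> with \<open>Y\<close>, so a map on the union is an
  arbitrary pair of maps on the parts, and the weights multiply.\<close>

lemma colouring_sum_Un:
  assumes fin: "finite X" "finite Y" and disj: "X \<inter> Y = {}"
    and r: "\<And>u v. u \<in> X \<Longrightarrow> v \<in> Y \<Longrightarrow> \<not> r u v \<and> \<not> r v u"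
  shows "colouring_sum q r m (X \<union> Y) = colouring_sum q r m X * colouring_sum q r m Y"
proof -
  let ?D = "decreasing_maps r m"
  let ?i = "\<lambda>(c, d) v. if v \<in> X then c v else d v"
  have "colouring_sum q r m (X \<union> Y) =
    (\<Sum>(c, d)\<in>?D X \<times> ?D Y. q ^ (\<Sum>v\<in>X. c v) * q ^ (\<Sum>v\<in>Y. d v))"
    unfolding colouring_sum_def
  proof (rule sum.reindex_bij_witness[where i = ?i and j = "\<lambda>c. (restrict c X, restrict c Y)"],
      goal_cases)
    case (1 c)
    then show ?case using decreasing_mapsD(2)[OF 1] by (auto simp: fun_eq_iff)
  next
    case (2 c)
    then show ?case using decreasing_mapsD[OF 2] by (auto intro!: decreasing_mapsI)
  next
    case (3 cd)
    then show ?case using disj decreasing_mapsD(2)[of "fst cd" r m X] decreasing_mapsD(2)[of "snd cd" r m Y]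
      by (cases cd) (fastforce simp: fun_eq_iff)
  next
    case (4 cd)
    then obtain c d where cd: "cd = (c, d)" "c \<in> ?D X" "d \<in> ?D Y" by auto
    show ?case using decreasing_mapsD[OF cd(2)] decreasing_mapsD[OF cd(3)] r
      unfolding cd(1) by (intro decreasing_mapsI) auto
  next
    case (5 c)
    then show ?case using fin disj by (simp add: sum.union_disjoint power_add)
  qed
  then show ?thesis by (simp add: colouring_sum_def sum_product sum.cartesian_product)
qed

lemma colouring_sum_Union:
  assumes "finite F" "\<And>X. X \<in> F \<Longrightarrow> finite X"
    and "\<And>X Y. X \<in> F \<Longrightarrow> Y \<in> F \<Longrightarrow> X \<noteq> Y \<Longrightarrow> X \<inter> Y = {}"
    and "\<And>X Y u v. X \<in> F \<Longrightarrow> Y \<in> F \<Longrightarrow> X \<noteq> Y \<Longrightarrow> u \<in> X \<Longrightarrow> v \<in> Y \<Longrightarrow> \<not> r u v"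
  shows "colouring_sum q r m (\<Union>F) = (\<Prod>X\<in>F. colouring_sum q r m X)"
  using assms
proof (induction F rule: finite_induct)
  case (insert X F)
  have "colouring_sum q r m (X \<union> \<Union>F) = colouring_sum q r m X * colouring_sum q r m (\<Union>F)"
  proof (rule colouring_sum_Un)
    show "finite X" "finite (\<Union>F)" using insert by auto
    show "X \<inter> \<Union>F = {}" using insert.hyps(2) insert.prems(2)[of X] by blast
    show "\<not> r u v \<and> \<not> r v u" if uv: "u \<in> X" "v \<in> \<Union>F" for u v
    proof -
      obtain Y where "Y \<in> F" "v \<in> Y" using uv(2) by blast
      moreover from this have "X \<noteq> Y" using insert.hyps(2) by blast
      ultimately show ?thesis using insert.prems(3)[of X Y u v] insert.prems(3)[of Y X v u] uv(1) by auto
    qed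
  qed
  moreover have "colouring_sum q r m (\<Union>F) = (\<Prod>X\<in>F. colouring_sum q r m X)"
  proof (rule insert.IH)
    show "finite Y" if "Y \<in> F" for Y using insert.prems(1) that by simp
    show "Y \<inter> Z = {}" if "Y \<in> F" "Z \<in> F" "Y \<noteq> Z" for Y Z
      using insert.prems(2)[of Y Z] that by simp
    show "\<not> r u v" if "Y \<in> F" "Z \<in> F" "Y \<noteq> Z" "u \<in> Y" "v \<in> Z" for Y Z u v
      using insert.prems(3)[of Y Z u v] that by simp
  qed
  ultimately show ?case using insert.hyps by simp
qed simp

lemma colouring_sum_Suc:
  assumes fin: "finite V" and z: "z \<in> V" "\<And>v. v \<in> V - {z} \<Longrightarrow> r z v" "\<And>v. v \<in> V \<Longrightarrow> \<not> r v z"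
  shows "colouring_sum q r (Suc m) V =
    colouring_sum q r m V + q ^ Suc m * colouring_sum q r m (V - {z})"
proof -
  let ?D = "decreasing_maps r"
  let ?w = "\<lambda>c. q ^ (\<Sum>v\<in>V. c v)"
  define A where "A = {c \<in> ?D (Suc m) V. c z = Suc m}"
  have top: "c v \<le> c z" if "c \<in> ?D k V" "v \<in> V" for c k v
    using decreasing_mapsD(3)[OF that(1) z(1)] that(2) z(2)[of v] by (cases "v = z") fastforce+
  have "?D (Suc m) V = ?D m V \<union> A"
  proof (intro equalityI subsetI)
    fix c assume c: "c \<in> ?D (Suc m) V"
    show "c \<in> ?D m V \<union> A"
    proof (cases "c z = Suc m")
      case False
      then have "c v \<le> m" if "v \<in> V" for v
        using top[OF c that] decreasing_mapsD(1)[OF c z(1)] by simp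
      then have "c \<in> ?D m V" using decreasing_mapsD[OF c] by (intro decreasing_mapsI)
      then show ?thesis ..
    qed (use c in \<open>simp add: A_def\<close>)
  next
    fix c assume "c \<in> ?D m V \<union> A"
    then show "c \<in> ?D (Suc m) V"
      by (auto simp: A_def intro!: decreasing_mapsI dest: decreasing_mapsD le_SucI)
  qed
  moreover have "?D m V \<inter> A = {}" using z(1) by (auto simp: A_def dest: decreasing_mapsD(1))
  moreover have "finite (?D m V)" "finite A"
    using finite_decreasing_maps[OF fin] by (simp_all add: A_def)
  ultimately have "colouring_sum q r (Suc m) V = colouring_sum q r m V + sum ?w A"
    by (simp add: colouring_sum_def sum.union_disjoint)
  \<comment> \<open>Once \<open>z\<close> has the top colour \<open>Suc m\<close>, the constraints
    involving \<open>z\<close> say only that the other colours are at most \<open>m\<close>;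
    removing \<open>z\<close> takes away exactly the factor \<open>q ^ Suc m\<close>.\<close>
  also have "sum ?w A = (\<Sum>c\<in>?D m (V - {z}). q ^ Suc m * q ^ (\<Sum>v\<in>V - {z}. c v))"
  proof (rule sum.reindex_bij_witness[where i = "\<lambda>c. c(z := Suc m)" and j = "\<lambda>c. restrict c (V - {z})"],
      goal_cases)
    case (1 c)
    then show ?case by (auto simp: A_def fun_eq_iff dest: decreasing_mapsD(2))
  next
    case (2 c)
    then have c: "c \<in> ?D (Suc m) V" and cz: "c z = Suc m" by (auto simp: A_def)
    have "c v \<le> m" if "v \<in> V - {z}" for v
      using decreasing_mapsD(3)[OF c z(1), of v] z(2)[OF that] that cz by simp
    then show ?case using decreasing_mapsD(3)[OF c] by (intro decreasing_mapsI) auto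
  next
    case (3 c)
    then show ?case by (auto simp: fun_eq_iff dest: decreasing_mapsD(2))
  next
    case (4 c)
    have "c(z := Suc m) \<in> ?D (Suc m) V"
      using decreasing_mapsD[OF 4] z by (intro decreasing_mapsI) (auto intro: le_SucI le_imp_less_Suc)
    then show ?case by (simp add: A_def)
  next
    case (5 c)
    then have "(\<Sum>v\<in>V. c v) = Suc m + (\<Sum>v\<in>V - {z}. c v)"
      using sum.remove[OF fin z(1), of c] by (simp add: A_def)
    then show ?case by (simp only: power_add restrict_apply cong: sum.cong) simp
  qed
  finally show ?thesis by (simp add: colouring_sum_def sum_distrib_left)
qed

section \<open>Counting colourings of a rooted tree by the root and by the support\<close>

lemma tree_less_root:
  assumes "rooted_tree t" "v \<in> verts t - {root t}"
  shows "tree_less t (root t) v"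
  using assms by (auto simp: tree_less_def root_le)

lemma not_tree_less_root:
  assumes "rooted_tree t"
  shows "\<not> tree_less t v (root t)"
proof -
  have "spath (adj t) (verts t) [root t] (root t) (root t)"
    using rooted_treeD(2)[OF assms] by (simp add: spath_def)
  then have "tree_le t v (root t) \<longleftrightarrow> v \<in> set [root t]" by (rule tree_le_iff_mem_spath[OF assms])
  then show ?thesis by (auto simp: tree_less_def)
qed

text \<open>Vertices of different branches are incomparable: whatever lies below \<open>v\<close> in
  the order is the root or belongs to the branch of \<open>v\<close>. The count on the forest
  therefore factors over the branches.\<close>

lemma colouring_sum_delete_root:
  assumes t: "rooted_tree t"
  shows "colouring_sum q (tree_less t) m (verts t - {root t}) =
    (\<Prod>C\<in>components (adj t) (verts t - {root t}).
      colouring_sum q (tree_less (induced t C (closest t C))) m C)"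
proof -
  note t' = rooted_treeD[OF t]
  let ?F = "components (adj t) (verts t - {root t})"
  have less: "tree_less t u v \<longleftrightarrow> tree_less (induced t C (closest t C)) u v"
    if "C \<in> ?F" "v \<in> C" "u \<noteq> root t" for C u v
    using tree_le_component[OF t that(1,2)] that(3) by (simp add: tree_less_def)
  have "colouring_sum q (tree_less t) m (\<Union>?F) = (\<Prod>C\<in>?F. colouring_sum q (tree_less t) m C)"
  proof (rule colouring_sum_Union)
    show "finite ?F" using t'(1) by (simp add: finite_components)
    show "finite C" if "C \<in> ?F" for C
      using components_subset[OF that] t'(1) finite_subset by blast
    show "C \<inter> D = {}" if "C \<in> ?F" "D \<in> ?F" "C \<noteq> D" for C D
      using components_disjoint t'(4) that by metis
    show "\<not> tree_less t u v" if CD: "C \<in> ?F" "D \<in> ?F" "C \<noteq> D" "u \<in> C" "v \<in> D" for C D u v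
    proof
      assume "tree_less t u v"
      moreover have "u \<noteq> root t" using components_subset[OF CD(1)] CD(4) by blast
      ultimately have "tree_le (induced t D (closest t D)) u v"
        using less[OF CD(2,5)] by (simp add: tree_less_def)
      then have "u \<in> D" by (auto simp: tree_le_iff_spath spath_def)
      then show False using components_disjoint[OF t'(4) CD(1-3)] CD(4) by blast
    qed
  qed
  also have "\<dots> = (\<Prod>C\<in>?F. colouring_sum q (tree_less (induced t C (closest t C))) m C)"
    by (intro prod.cong refl colouring_sum_cong less) (use components_subset in blast)+
  finally show ?thesis by (simp add: components_Union)
qed

text \<open>Colours grow towards the root, so the path from a vertex of nonzero colour to the root
  keeps nonzero colours, which makes \<open>X\<close> connected. Adjacent vertices are comparable,
  hence cannot both have colour 0.\<close>

lemma root_subtree_support: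
  assumes t: "rooted_tree t" and c: "c \<in> decreasing_maps (tree_less t) m (verts t)" "c (root t) \<noteq> 0"
  defines "X \<equiv> {v \<in> verts t. c v \<noteq> 0}"
  shows "X \<in> root_subtrees t" "independent_in (adj t) (verts t - X)"
proof -
  note t' = rooted_treeD[OF t]
  have conn: "(v, root t) \<in> (Restr (adj t) X)\<^sup>*" if "v \<in> X" for v
  proof -
    have v: "v \<in> verts t" "c v \<noteq> 0" using that by (auto simp: X_def)
    obtain p where p: "spath (adj t) (verts t) p v (root t)" using rooted_tree_spath[OF t v(1)] .
    have "u \<in> X" if "u \<in> set p" for u
    proof -
      have "u \<in> verts t" using p that by (auto simp: spath_def)
      moreover have "tree_le t u v" using p that tree_le_iff_spath by metis
      then have "c v \<le> c u"
        using decreasing_mapsD(3)[OF c(1) \<open>u \<in> verts t\<close> v(1)] by (cases "u = v") (auto simp: tree_less_def)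
      ultimately show ?thesis using v(2) by (simp add: X_def)
    qed
    then have "spath (adj t) X p v (root t)" using p by (auto simp: spath_def)
    then show ?thesis using spath_rtrancl[OF _ t'(4)] spath_hd_in spath_last_in by metis
  qed
  have "connected_in (adj t) X"
    unfolding connected_in_def
    using conn sym_rtrancl_Restr[OF t'(4), of X] by (meson rtrancl_trans symD)
  then show "X \<in> root_subtrees t" using t'(2) c(2) by (auto simp: root_subtrees_def X_def)
  show "independent_in (adj t) (verts t - X)"
  proof -
    have False if "(a, b) \<in> adj t" "a \<in> verts t - X" "b \<in> verts t - X" for a b
      using adj_comparable[OF t that(1)] decreasing_mapsD(3)[OF c(1), of a b]
        decreasing_mapsD(3)[OF c(1), of b a] that by (auto simp: X_def)
    then show ?thesis by (auto simp: independent_in_def)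
  qed
qed

text \<open>Vertices outside \<open>X\<close> are maximal: if \<open>u < v\<close> with
  \<open>u\<close> outside, then \<open>v\<close> is outside too, and the neighbour \<open>w\<close>
  of \<open>v\<close> towards the root lies in \<open>X\<close> because the complement has no edges;
  but \<open>u\<close> is below or equal to \<open>w\<close>, which forces \<open>u\<close> into
  \<open>X\<close>. Consequently colour 0 on the complement breaks no constraint.\<close>

lemma not_less_outside_root_subtree:
  assumes t: "rooted_tree t" and X: "X \<in> root_subtrees t" and ind: "independent_in (adj t) (verts t - X)"
    and uv: "tree_less t u v" "u \<notin> X" "v \<in> verts t"
  shows False
proof -
  note t' = rooted_treeD[OF t]
  have v: "v \<notin> X" using root_subtree_down_closed[OF t X] uv by (auto simp: tree_less_def)
  obtain p where p: "spath (adj t) (verts t) p v (root t)" using rooted_tree_spath[OF t uv(3)] .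
  have "p \<noteq> []" "hd p = v" "last p = root t" using p by (auto simp: spath_def)
  moreover have "v \<noteq> root t" using v X by (auto simp: root_subtrees_def)
  ultimately obtain w ps where pe: "p = v # w # ps" by (cases p; cases "tl p") auto
  have w: "(v, w) \<in> adj t" "spath (adj t) (verts t) (w # ps) w (root t)"
    using p unfolding pe by (auto simp: spath_def)
  have "w \<in> X" using ind w uv(3) v t'(3) by (auto simp: independent_in_def)
  moreover have "u \<in> set (w # ps)"
    using tree_le_iff_mem_spath[OF t p] uv(1) by (auto simp: pe tree_less_def)
  then have "tree_le t u w" using tree_le_iff_mem_spath[OF t w(2)] by blast
  ultimately show False using root_subtree_down_closed[OF t X] uv(2) by blast
qed

lemma finite_root_subtrees: "rooted_tree t \<Longrightarrow> finite (root_subtrees t)"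
  using rooted_treeD(1)[of t] by (simp add: root_subtrees_def)

text \<open>Lowering every colour on \<open>X\<close> by 1 is a bijection onto the decreasing maps
  on \<open>X\<close> with values up to \<open>m\<close>; the exponent of \<open>q\<close> drops by
  \<open>card X\<close>. The inverse raises the colours on \<open>X\<close> and puts 0
  elsewhere.\<close>

lemma colouring_sum_support:
  assumes t: "rooted_tree t" and X: "X \<in> root_subtrees t" and ind: "independent_in (adj t) (verts t - X)"
  shows "(\<Sum>c | c \<in> decreasing_maps (tree_less t) (Suc m) (verts t) \<and> c (root t) \<noteq> 0 \<and>
        {v \<in> verts t. c v \<noteq> 0} = X. q ^ (\<Sum>v\<in>verts t. c v)) =
    q ^ card X * colouring_sum q (tree_less t) m X"
proof -
  let ?V = "verts t" and ?D = "decreasing_maps (tree_less t)"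
  let ?A = "{c. c \<in> ?D (Suc m) ?V \<and> c (root t) \<noteq> 0 \<and> {v \<in> ?V. c v \<noteq> 0} = X}"
  have fin: "finite ?V" and XV: "X \<subseteq> ?V" and rX: "root t \<in> X"
    using rooted_treeD(1)[OF t] X by (auto simp: root_subtrees_def)
  have "(\<Sum>c\<in>?A. q ^ (\<Sum>v\<in>?V. c v)) = (\<Sum>c\<in>?D m X. q ^ card X * q ^ (\<Sum>v\<in>X. c v))"
  proof (rule sum.reindex_bij_witness[where
        i = "\<lambda>c. restrict (\<lambda>v. if v \<in> X then Suc (c v) else 0) ?V" and
        j = "\<lambda>c. restrict (\<lambda>v. c v - 1) X"], goal_cases)
    case (1 c)
    then show ?case using XV by (auto simp: fun_eq_iff dest: decreasing_mapsD(2))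
  next
    case (2 c)
    then have c: "c \<in> ?D (Suc m) ?V" and pos: "\<And>v. v \<in> X \<Longrightarrow> c v > 0" by auto
    show ?case
    proof (rule decreasing_mapsI)
      show "restrict (\<lambda>v. c v - 1) X v \<le> m" if "v \<in> X" for v
        using decreasing_mapsD(1)[OF c, of v] that XV by auto
      show "restrict (\<lambda>v. c v - 1) X v < restrict (\<lambda>v. c v - 1) X u"
        if "u \<in> X" "v \<in> X" "tree_less t u v" for u v
      proof -
        have "c v < c u" using decreasing_mapsD(3)[OF c, of u v] that XV by blast
        then show ?thesis using pos[OF that(2)] that by simp
      qed
    qed simp
  next
    case (3 c)
    then show ?case using XV by (auto simp: fun_eq_iff dest: decreasing_mapsD(2))
  next
    case (4 c)
    have "restrict (\<lambda>v. if v \<in> X then Suc (c v) else 0) ?V \<in> ?D (Suc m) ?V"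
    proof (rule decreasing_mapsI)
      fix u v assume uv: "u \<in> ?V" "v \<in> ?V" "tree_less t u v"
      then have "u \<in> X" using not_less_outside_root_subtree[OF t X ind] by blast
      then show "restrict (\<lambda>v. if v \<in> X then Suc (c v) else 0) ?V v <
          restrict (\<lambda>v. if v \<in> X then Suc (c v) else 0) ?V u"
        using decreasing_mapsD(3)[OF 4 _ _ uv(3)] uv by simp
    qed (use decreasing_mapsD(1)[OF 4] in auto)
    then show ?case using XV rX by auto
  next
    case (5 c)
    then have c: "\<And>v. v \<in> X \<Longrightarrow> c v > 0" "\<And>v. v \<in> ?V - X \<Longrightarrow> c v = 0" by auto
    have "(\<Sum>v\<in>?V. c v) = (\<Sum>v\<in>X. c v)"
      using c(2) fin XV by (intro sum.mono_neutral_right) auto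
    \<comment> \<open>Truncated subtraction is harmless here, as the colours on \<open>X\<close> are
      positive.\<close>
    also have "\<dots> = (\<Sum>v\<in>X. 1 + (c v - 1))"
      using c(1) by (intro sum.cong) auto
    also have "\<dots> = card X + (\<Sum>v\<in>X. c v - 1)" by (simp only: sum.distrib card_eq_sum)
    finally show ?case by (simp add: power_add)
  qed
  then show ?thesis by (simp add: colouring_sum_def sum_distrib_left)
qed

text \<open>Colourings with root colour 0 have a support without the root and are counted apart. All
  other colours would have to be smaller than 0, so such a colouring exists only on the one-vertex
  tree, where it is unique and has weight 1.\<close>

lemma colouring_sum_Suc_support:
  assumes t: "rooted_tree t"
  shows "colouring_sum q (tree_less t) (Suc m) (verts t) =
    (\<Sum>X | X \<in> root_subtrees t \<and> independent_in (adj t) (verts t - X).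
        q ^ card X * colouring_sum q (tree_less t) m X) +
    (if verts t = {root t} then 1 else 0)"
proof -
  note t' = rooted_treeD[OF t]
  let ?V = "verts t" and ?D = "decreasing_maps (tree_less t) (Suc m) (verts t)"
  let ?w = "\<lambda>c. q ^ (\<Sum>v\<in>?V. c v)" and ?S = "\<lambda>c. {v \<in> ?V. c v \<noteq> 0}"
  let ?XX = "{X. X \<in> root_subtrees t \<and> independent_in (adj t) (?V - X)}"
  define A where "A = {c \<in> ?D. c (root t) \<noteq> 0}"
  define B where "B = {c \<in> ?D. c (root t) = 0}"
  have fin: "finite ?D" using t'(1) by (rule finite_decreasing_maps)
  have "?D = A \<union> B" "A \<inter> B = {}" by (auto simp: A_def B_def)
  moreover have "finite A" "finite B" using fin by (simp_all add: A_def B_def)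
  ultimately have "colouring_sum q (tree_less t) (Suc m) ?V = sum ?w A + sum ?w B"
    by (simp add: colouring_sum_def sum.union_disjoint)
  also have "sum ?w A = (\<Sum>X\<in>?XX. sum ?w {c. c \<in> A \<and> ?S c = X})"
    using root_subtree_support[OF t] fin finite_root_subtrees[OF t]
    by (intro sum.group[symmetric]) (auto simp: A_def)
  also have "\<dots> = (\<Sum>X\<in>?XX. q ^ card X * colouring_sum q (tree_less t) m X)"
  proof (rule sum.cong)
    fix X assume "X \<in> ?XX"
    then show "sum ?w {c. c \<in> A \<and> ?S c = X} = q ^ card X * colouring_sum q (tree_less t) m X"
      using colouring_sum_support[OF t, of X q m] by (simp add: A_def conj_assoc)
  qed simp
  also have "sum ?w B = (if ?V = {root t} then 1 else 0)"
  proof (cases "?V = {root t}")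
    case True
    have "B = {restrict (\<lambda>_. 0) ?V}"
      using True not_tree_less_root[OF t]
      by (auto simp: B_def fun_eq_iff dest: decreasing_mapsD(2) intro!: decreasing_mapsI)
    then show ?thesis using True by simp
  next
    case False
    then obtain v where v: "v \<in> ?V - {root t}" using t'(2) by blast
    have "c (root t) > 0" if "c \<in> ?D" for c
      using decreasing_mapsD(3)[OF that t'(2) _ tree_less_root[OF t v]] v by simp
    then have "B = {}" by (auto simp: B_def)
    then show ?thesis using False by simp
  qed
  finally show ?thesis .
qed

section \<open>Isomorphism classes\<close>

lemma rooted_tree_rep: "rooted_tree (rep_tree T)"
  using Quotient3_rep_reflp[OF Quotient3_tree] by (simp add: same_tree_def)

lemma abs_rep_tree: "abs_tree (rep_tree T) = T"
  by (rule Quotient3_abs_rep[OF Quotient3_tree])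

lemma same_tree_refl: "rooted_tree s \<Longrightarrow> same_tree s s"
  by (simp add: same_tree_def rooted_iso_refl)

lemma rooted_iso_rep_abs:
  assumes "rooted_tree s"
  shows "rooted_iso s (rep_tree (abs_tree s))"
proof -
  have "same_tree (rep_tree (abs_tree s)) s"
    by (rule Quotient3_rep_abs[OF Quotient3_tree same_tree_refl[OF assms]])
  then show ?thesis by (auto simp: same_tree_def intro: rooted_iso_sym)
qed

lemma tree_size_abs:
  assumes "rooted_tree s"
  shows "tree_size (abs_tree s) = card (verts s)"
  using rooted_iso_rep_abs[OF assms] by (auto simp: rooted_iso_def tree_size_def dest: bij_betw_same_card)

lemma tree_size_pos: "tree_size T > 0"
  using rooted_treeD(1,2)[OF rooted_tree_rep[of T]] by (auto simp: tree_size_def card_gt_0_iff)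

lemma abs_tree_eq_bullet_iff:
  assumes s: "rooted_tree s"
  shows "abs_tree s = bullet \<longleftrightarrow> card (verts s) = 1"
proof
  assume "abs_tree s = bullet"
  then show "card (verts s) = 1"
    using tree_size_abs[OF s] tree_size_abs[OF rooted_tree_singleton[of 0]] by (simp add: bullet_def)
next
  assume "card (verts s) = 1"
  then have v: "verts s = {root s}"
    using rooted_treeD(2)[OF s] by (auto simp: card_1_singleton_iff)
  then have "adj s = {}" using rooted_treeD(3,5)[OF s] by (auto simp: irrefl_def)
  then have "rooted_iso s (RGraph {0::nat} {} 0)"
    unfolding rooted_iso_def by (intro exI[of _ "\<lambda>_. 0"]) (simp add: v bij_betw_def)
  then have "same_tree s (RGraph {0} {} 0)" using s by (simp add: same_tree_def rooted_tree_singleton)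
  then show "abs_tree s = bullet"
    unfolding bullet_def by (rule Quotient3_rel_abs[OF Quotient3_tree])
qed

lemma bullet_series_abs:
  "rooted_tree s \<Longrightarrow> bullet_series (abs_tree s) = (if card (verts s) = 1 then 1 else 0)"
  by (simp add: bullet_series_def abs_tree_eq_bullet_iff)

lemma bullet_series_rep:
  "bullet_series T = (if verts (rep_tree T) = {root (rep_tree T)} then 1 else 0)"
proof -
  have "card (verts (rep_tree T)) = 1 \<longleftrightarrow> verts (rep_tree T) = {root (rep_tree T)}"
    using rooted_treeD(2)[OF rooted_tree_rep[of T]] by (auto simp: card_1_singleton_iff)
  then show ?thesis using bullet_series_abs[OF rooted_tree_rep[of T]] by (simp add: abs_rep_tree)
qed

text \<open>An isomorphism carries the path from \<open>v\<close> to the root to a path from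
  \<open>f v\<close> to the root, and that path determines the order below
  \<open>f v\<close>.\<close>

lemma tree_less_iso:
  assumes s: "rooted_tree s" and t: "rooted_tree t"
    and f: "bij_betw f (verts s) (verts t)" "f (root s) = root t"
      "\<forall>u\<in>verts s. \<forall>v\<in>verts s. (u, v) \<in> adj s \<longleftrightarrow> (f u, f v) \<in> adj t"
    and uv: "u \<in> verts s" "v \<in> verts s"
  shows "tree_less s u v \<longleftrightarrow> tree_less t (f u) (f v)"
proof -
  obtain p where p: "spath (adj s) (verts s) p v (root s)" using rooted_tree_spath[OF s uv(2)] .
  have inj: "inj_on f (verts s)" and im: "f ` verts s = verts t"
    using f(1) by (auto simp: bij_betw_def)
  have pV: "set p \<subseteq> verts s" using p by (simp add: spath_def)
  have "successively (\<lambda>a b. (f a, f b) \<in> adj t) p"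
    using p pV f(3) by (auto simp: spath_def elim!: successively_mono)
  moreover have "distinct (map f p)"
    using p pV inj by (auto simp: spath_def distinct_map intro: inj_on_subset)
  ultimately have "spath (adj t) (verts t) (map f p) (f v) (root t)"
    using p pV f(2) im by (auto simp: spath_def successively_map hd_map last_map)
  then have "tree_le t (f u) (f v) \<longleftrightarrow> f u \<in> set (map f p)" by (rule tree_le_iff_mem_spath[OF t])
  also have "\<dots> \<longleftrightarrow> u \<in> set p" using inj uv(1) pV by (auto simp: inj_on_image_mem_iff)
  also have "\<dots> \<longleftrightarrow> tree_le s u v" by (rule tree_le_iff_mem_spath[OF s p, symmetric])
  finally show ?thesis using inj uv by (auto simp: tree_less_def inj_on_eq_iff)
qed

text \<open>\<open>G_series\<close> is defined on the representative chosen by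
  \<open>rep_tree\<close>; with this lemma it can be computed on the induced graphs that occur in
  \<open>Crls_diamond\<close>.\<close>

lemma G_series_abs:
  assumes s: "rooted_tree s"
  shows "G_series m (abs_tree s) = colouring_sum q_var (tree_less s) m (verts s)"
proof -
  let ?t = "rep_tree (abs_tree s)"
  obtain f where f: "bij_betw f (verts s) (verts ?t)" "f (root s) = root ?t"
      "\<forall>u\<in>verts s. \<forall>v\<in>verts s. (u, v) \<in> adj s \<longleftrightarrow> (f u, f v) \<in> adj ?t"
    using rooted_iso_rep_abs[OF s] unfolding rooted_iso_def by blast
  have "colouring_sum q_var (tree_less s) m (verts s) = colouring_sum q_var (tree_less ?t) m (verts ?t)"
    using tree_less_iso[OF s rooted_tree_rep f] by (intro colouring_sum_bij[OF f(1)])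
  then show ?thesis
    by (simp add: G_series_def colouring_sum_def colourings_def decreasing_maps_def Let_def)
qed

section \<open>The two substitutions occurring in the equation\<close>

abbreviation subtree_at :: "tree \<Rightarrow> nat set \<Rightarrow> tree" where
  "subtree_at T X \<equiv> abs_tree (induced (rep_tree T) X (root (rep_tree T)))"

abbreviation component_tree :: "tree \<Rightarrow> nat set \<Rightarrow> tree" where
  "component_tree T C \<equiv> abs_tree (induced (rep_tree T) C (closest (rep_tree T) C))"

abbreviation branches :: "tree \<Rightarrow> nat set set" where
  "branches T \<equiv> components (adj (rep_tree T)) (verts (rep_tree T) - {root (rep_tree T)})"

text \<open>What remains of the tree after cutting off a set of leaves: the index set of the nonzero
  terms of \<open>Crls_diamond\<close> with second argument -bullet.\<close>

definition prunings :: "tree \<Rightarrow> nat set set" where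
  "prunings T = {X. X \<in> root_subtrees (rep_tree T) \<and>
    independent_in (adj (rep_tree T)) (verts (rep_tree T) - X)}"

lemma rooted_tree_root_subtree:
  "rooted_tree t \<Longrightarrow> X \<in> root_subtrees t \<Longrightarrow> rooted_tree (induced t X (root t))"
  by (intro rooted_tree_induced) (auto simp: root_subtrees_def)

text \<open>A component of the complement gives the factor -1 if it is a single vertex and 0
  otherwise. The product survives only if all components are single vertices, and then there are as
  many as removed vertices.\<close>

lemma Crls_diamond_neg_bullet:
  fixes A :: "'r::comm_ring_1 tree_series"
  shows "Crls_diamond A (\<lambda>T'. - bullet_series T') T =
    (\<Sum>X\<in>prunings T. A (subtree_at T X) * (- 1) ^ card (verts (rep_tree T) - X))"
proof -
  let ?t = "rep_tree T" and ?V = "verts (rep_tree T)"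
  note t = rooted_tree_rep[of T]
  have P: "(\<Prod>C\<in>components (adj ?t) (?V - X). - bullet_series (component_tree T C)) =
      (if independent_in (adj ?t) (?V - X) then (- 1) ^ card (?V - X) else (0::'r))" for X
  proof -
    have b: "bullet_series (component_tree T C) = (if card C = 1 then 1 else (0::'r))"
      if "C \<in> components (adj ?t) (?V - X)" for C
      using bullet_series_abs[OF rooted_tree_component[OF t _ that]] by simp
    show ?thesis
    proof (cases "independent_in (adj ?t) (?V - X)")
      case True
      have "(\<Prod>C\<in>components (adj ?t) (?V - X). - bullet_series (component_tree T C)) =
          (\<Prod>C\<in>(\<lambda>u. {u}) ` (?V - X). - (1::'r))"
        using b by (intro prod.cong components_independent[OF True])
          (auto simp: components_independent[OF True])
      then show ?thesis using True by (simp add: card_image)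
    next
      case False
      then obtain C where C: "C \<in> components (adj ?t) (?V - X)" "card C \<noteq> 1"
        using components_not_independent rooted_treeD(5)[OF t] by metis
      have "finite (components (adj ?t) (?V - X))"
        using rooted_treeD(1)[OF t] by (simp add: finite_components)
      moreover have "- bullet_series (component_tree T C) = (0::'r)" using b[OF C(1)] C(2) by simp
      ultimately have "(\<Prod>C\<in>components (adj ?t) (?V - X). - bullet_series (component_tree T C)) = (0::'r)"
        using C(1) by (intro prod_zero) blast+
      then show ?thesis using False by simp
    qed
  qed
  show ?thesis
    unfolding Crls_diamond_def Let_def P prunings_def
    by (intro sum.mono_neutral_cong_right) (use finite_root_subtrees[OF t] in auto)
qed

lemma singleton_root_subtree:
  assumes "rooted_tree t"
  shows "{root t} \<in> root_subtrees t"
  using rooted_treeD(2)[OF assms] by (simp add: root_subtrees_def connected_in_def)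

text \<open>Only the root subtree with one vertex has a nonzero coefficient in the first
  argument.\<close>

lemma Crls_diamond_bullet:
  fixes B :: "'r::comm_ring_1 tree_series"
  shows "Crls_diamond bullet_series B T = (\<Prod>C\<in>branches T. B (component_tree T C))"
proof -
  let ?t = "rep_tree T" and ?V = "verts (rep_tree T)"
  note t = rooted_tree_rep[of T]
  have b: "bullet_series (subtree_at T X) = (if X = {root ?t} then 1 else (0::'r))"
    if "X \<in> root_subtrees ?t" for X
  proof -
    have "card X = 1 \<longleftrightarrow> X = {root ?t}"
      using that by (auto simp: card_1_singleton_iff root_subtrees_def)
    then show ?thesis using bullet_series_abs[OF rooted_tree_root_subtree[OF t that]] by simp
  qed
  have "Crls_diamond bullet_series B T = (\<Sum>X\<in>{{root ?t}}. bullet_series (subtree_at T X) *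
      (\<Prod>C\<in>components (adj ?t) (?V - X). B (component_tree T C)))"
    unfolding Crls_diamond_def Let_def
    using finite_root_subtrees[OF t] singleton_root_subtree[OF t]
    by (intro sum.mono_neutral_right) (auto simp: b)
  then show ?thesis by (simp add: b[OF singleton_root_subtree[OF t]])
qed

lemma finite_prunings: "finite (prunings T)"
  using finite_root_subtrees[OF rooted_tree_rep[of T]] by (simp add: prunings_def)

lemma prunings_subset: "X \<in> prunings T \<Longrightarrow> X \<subseteq> verts (rep_tree T)"
  by (auto simp: prunings_def root_subtrees_def)

lemma tree_size_subtree_at:
  "X \<in> prunings T \<Longrightarrow> tree_size (subtree_at T X) = card X"
  using tree_size_abs[OF rooted_tree_root_subtree[OF rooted_tree_rep]] by (simp add: prunings_def)

lemma verts_in_prunings: "verts (rep_tree T) \<in> prunings T"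
  using rooted_treeD(2,6)[OF rooted_tree_rep[of T]]
  by (simp add: prunings_def root_subtrees_def independent_in_def)

lemma subtree_at_verts: "subtree_at T (verts (rep_tree T)) = T"
proof -
  have "induced (rep_tree T) (verts (rep_tree T)) (root (rep_tree T)) = rep_tree T"
    using rooted_treeD(3)[OF rooted_tree_rep[of T]] by (cases "rep_tree T") (auto simp: induced_def)
  then show ?thesis by (simp add: abs_rep_tree)
qed

lemma tree_size_subtree_at_less:
  assumes "X \<in> prunings T" "X \<noteq> verts (rep_tree T)"
  shows "tree_size (subtree_at T X) < tree_size T"
  using assms prunings_subset[OF assms(1)] rooted_treeD(1)[OF rooted_tree_rep[of T]]
  unfolding tree_size_subtree_at[OF assms(1)] by (auto simp: tree_size_def intro: psubset_card_mono)

lemma tree_size_component_tree: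
  "C \<in> branches T \<Longrightarrow> tree_size (component_tree T C) = card C"
  using tree_size_abs[OF rooted_tree_component[OF rooted_tree_rep Diff_subset]] by simp

lemma tree_size_component_tree_less:
  assumes "C \<in> branches T"
  shows "tree_size (component_tree T C) < tree_size T"
  using components_subset[OF assms] rooted_treeD(1,2)[OF rooted_tree_rep[of T]]
  unfolding tree_size_component_tree[OF assms]
  by (auto simp: tree_size_def intro!: psubset_card_mono)

section \<open>The equation over an arbitrary ring\<close>

text \<open>Here \<open>a\<close> stands for q and \<open>b\<close> for q (1 + (q-1) x). The ring is
  left open so that the equation can be moved from Q(q)[x] to Q(q).\<close>

definition crl_equation :: "'r::comm_ring_1 \<Rightarrow> 'r \<Rightarrow> 'r tree_series \<Rightarrow> bool" where
  "crl_equation a b S \<longleftrightarrow> (\<forall>T. a * Sigma_series a S T - Crls_diamond S (\<lambda>T'. - bullet_series T') T =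
     b * Crls_diamond bullet_series (\<lambda>T'. a * Sigma_series a S T') T - bullet_series T)"

text \<open>The part of the equation that involves only trees smaller than \<open>T\<close>: the
  full vertex set is excluded from the prunings because its term, the coefficient at
  \<open>T\<close> itself, joins the left-hand side and turns \<open>a ^ tree_size T\<close> into
  \<open>a ^ tree_size T - 1\<close>.\<close>

definition crl_step :: "'r::comm_ring_1 \<Rightarrow> 'r \<Rightarrow> 'r tree_series \<Rightarrow> 'r tree_series" where
  "crl_step a b S T =
    b * (\<Prod>C\<in>branches T. a ^ card C * S (component_tree T C)) - bullet_series T +
    (\<Sum>X\<in>prunings T - {verts (rep_tree T)}.
      S (subtree_at T X) * (- 1) ^ card (verts (rep_tree T) - X))"

lemma times_Sigma_series: "a * Sigma_series a S T = a ^ tree_size T * S T"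
  using tree_size_pos[of T] by (cases "tree_size T") (simp_all add: Sigma_series_def)

lemma crl_equation_expanded:
  "crl_equation a b S \<longleftrightarrow> (\<forall>T. a ^ tree_size T * S T -
      (\<Sum>X\<in>prunings T. S (subtree_at T X) * (- 1) ^ card (verts (rep_tree T) - X)) =
    b * (\<Prod>C\<in>branches T. a ^ card C * S (component_tree T C)) - bullet_series T)"
  unfolding crl_equation_def times_Sigma_series Crls_diamond_neg_bullet Crls_diamond_bullet
  by (simp add: tree_size_component_tree cong: prod.cong)

lemma crl_equation_iff_step:
  "crl_equation a b S \<longleftrightarrow> (\<forall>T. (a ^ tree_size T - 1) * S T = crl_step a b S T)"
proof -
  have "(\<Sum>X\<in>prunings T. S (subtree_at T X) * (- 1) ^ card (verts (rep_tree T) - X)) =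
      S T + (\<Sum>X\<in>prunings T - {verts (rep_tree T)}.
        S (subtree_at T X) * (- 1) ^ card (verts (rep_tree T) - X))" for T
    using sum.remove[OF finite_prunings verts_in_prunings[of T],
        of "\<lambda>X. S (subtree_at T X) * (- 1) ^ card (verts (rep_tree T) - X)"]
    by (simp add: subtree_at_verts)
  then show ?thesis
    unfolding crl_equation_expanded crl_step_def by (auto simp: algebra_simps)
qed

lemma crl_step_cong:
  assumes "\<And>T'. tree_size T' < tree_size T \<Longrightarrow> S T' = S' T'"
  shows "crl_step a b S T = crl_step a b S' T"
  unfolding crl_step_def
  using assms tree_size_subtree_at_less tree_size_component_tree_less
  by (auto intro!: arg_cong2[where f = "(+)"] arg_cong2[where f = "(-)"] arg_cong2[where f = "(*)"]
      sum.cong prod.cong)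

lemma crl_equation_unique:
  fixes a :: "'r::idom"
  assumes a: "\<And>k. k > 0 \<Longrightarrow> a ^ k \<noteq> 1" and S: "crl_equation a b S" "crl_equation a b S'"
  shows "S = S'"
proof
  fix T
  show "S T = S' T"
  proof (induction "tree_size T" arbitrary: T rule: less_induct)
    case less
    have "(a ^ tree_size T - 1) * S T = (a ^ tree_size T - 1) * S' T"
      using S crl_step_cong[of T S S' a b] less by (simp add: crl_equation_iff_step)
    then show ?case using a[OF tree_size_pos[of T]] by simp
  qed
qed

text \<open>Well-founded recursion on the size of the tree. Division is replaced by explicit
  inverses \<open>u k\<close> of \<open>a ^ k - 1\<close>, since the ring in question, Q(q)[x], is
  not a field.\<close>

lemma crl_equation_exists:
  assumes u: "\<And>k. k > 0 \<Longrightarrow> (a ^ k - 1) * u k = 1"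
  shows "\<exists>S. crl_equation a b S"
proof -
  define F where "F = (\<lambda>S T. u (tree_size T) * crl_step a b S T)"
  have "adm_wf (measure tree_size) F"
    unfolding adm_wf_def F_def using crl_step_cong by (metis in_measure)
  then have "wfrec (measure tree_size) F = F (wfrec (measure tree_size) F)"
    by (intro wfrec_fixpoint) auto
  then obtain S where "S = F S" by blast
  then have "(a ^ tree_size T - 1) * S T = ((a ^ tree_size T - 1) * u (tree_size T)) * crl_step a b S T" for T
    unfolding mult.assoc by (metis F_def)
  then have "crl_equation a b S" by (simp add: crl_equation_iff_step u[OF tree_size_pos])
  then show ?thesis by blast
qed

section \<open>Transport of the equation along ring homomorphisms\<close>

locale ring_homomorphism =
  fixes h :: "'a::comm_ring_1 \<Rightarrow> 'b::comm_ring_1"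
  assumes hom_add: "h (x + y) = h x + h y" and hom_mult: "h (x * y) = h x * h y" and hom_1: "h 1 = 1"
begin

lemma hom_0: "h 0 = 0"
  using hom_add[of 0 0] by simp

lemma hom_minus: "h (- x) = - h x"
  using hom_add[of x "- x"] by (simp add: hom_0 eq_neg_iff_add_eq_0 add.commute)

lemma hom_diff: "h (x - y) = h x - h y"
  using hom_add[of x "- y"] by (simp add: hom_minus)

lemma hom_power: "h (x ^ k) = h x ^ k"
  by (induction k) (simp_all add: hom_1 hom_mult)

lemma hom_sum: "h (sum f A) = (\<Sum>x\<in>A. h (f x))"
  by (induction A rule: infinite_finite_induct) (simp_all add: hom_0 hom_add)

lemma hom_prod: "h (prod f A) = (\<Prod>x\<in>A. h (f x))"
  by (induction A rule: infinite_finite_induct) (simp_all add: hom_1 hom_mult)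

lemma crl_equation_hom:
  assumes "crl_equation a b S"
  shows "crl_equation (h a) (h b) (\<lambda>T. h (S T))"
proof -
  have bullet: "h (bullet_series T) = bullet_series T" for T
    by (simp add: bullet_series_def hom_0 hom_1)
  have "(h a ^ tree_size T - 1) * h (S T) = crl_step (h a) (h b) (\<lambda>T. h (S T)) T" for T
  proof -
    have "h ((a ^ tree_size T - 1) * S T) = h (crl_step a b S T)"
      using assms by (simp add: crl_equation_iff_step)
    then show ?thesis
      by (simp add: crl_step_def hom_add hom_diff hom_mult hom_power hom_sum hom_prod hom_1
          hom_minus bullet)
  qed
  then show ?thesis by (simp add: crl_equation_iff_step)
qed

end

section \<open>The colouring series solves the specialised equation\<close>

lemma q_var_nonzero: "q_var \<noteq> 0"
  by (simp add: q_var_def)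

text \<open>The series is -q Sigma_{-q} G with the two powers of -q merged. The identity
  \<open>key\<close> of counts, multiplied by \<open>(- 1) ^ tree_size T\<close>, is the equation at
  \<open>T\<close>.\<close>

lemma crl_equation_G_series:
  "crl_equation (1 / q_var) (q_var ^ Suc m) (\<lambda>T. (- q_var) ^ tree_size T * G_series m T)"
  unfolding crl_equation_expanded
proof
  fix T
  let ?t = "rep_tree T" and ?V = "verts (rep_tree T)" and ?N = "tree_size T"
  let ?W = "colouring_sum q_var (tree_less ?t)"
  note t = rooted_tree_rep[of T]
  note t' = rooted_treeD[OF t]
  let ?P = "\<Prod>C\<in>branches T. G_series m (component_tree T C)"
  let ?Q = "\<Sum>X\<in>prunings T. q_var ^ card X * G_series m (subtree_at T X)"
  have N: "?N = card ?V" by (simp add: tree_size_def)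
  have cancel: "(1 / q_var) ^ k * ((- q_var) ^ k * z) = (- 1) ^ k * z" for k z
  proof -
    have "(1 / q_var) ^ k * (- q_var) ^ k = (- 1) ^ k"
      using q_var_nonzero by (simp flip: power_mult_distrib)
    then show ?thesis by (simp flip: mult.assoc)
  qed
  have "G_series m T + q_var ^ Suc m * ?P = ?W (Suc m) ?V"
  proof -
    have "?W (Suc m) ?V = ?W m ?V + q_var ^ Suc m * ?W m (?V - {root ?t})"
      using t'(1,2) tree_less_root[OF t] not_tree_less_root[OF t] by (intro colouring_sum_Suc)
    moreover have "?W m ?V = G_series m T"
      using G_series_abs[OF t] by (simp add: abs_rep_tree)
    moreover have "?W m (?V - {root ?t}) = ?P"
      unfolding colouring_sum_delete_root[OF t]
      using G_series_abs[OF rooted_tree_component[OF t Diff_subset]] by (intro prod.cong) auto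
    ultimately show ?thesis by simp
  qed
  also have "\<dots> = ?Q + bullet_series T"
  proof -
    have "?W m X = G_series m (subtree_at T X)" if "X \<in> root_subtrees ?t" for X
    proof -
      have "?W m X = colouring_sum q_var (tree_less (induced ?t X (root ?t))) m X"
        by (rule colouring_sum_cong) (simp add: tree_less_def tree_le_root_subtree[OF t that])
      then show ?thesis using G_series_abs[OF rooted_tree_root_subtree[OF t that]] by simp
    qed
    then show ?thesis
      unfolding colouring_sum_Suc_support[OF t] bullet_series_rep prunings_def
      by (intro arg_cong2[where f = "(+)"] sum.cong) auto
  qed
  finally have key: "G_series m T + q_var ^ Suc m * ?P = ?Q + bullet_series T" .
  \<comment> \<open>The sign from \<open>(- q_var) ^ card X\<close> and the sign of the removed
    leaves combine to \<open>(- 1) ^ ?N\<close>, the same for every \<open>X\<close>.\<close>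
  have "(\<Sum>X\<in>prunings T. (- q_var) ^ tree_size (subtree_at T X) * G_series m (subtree_at T X) *
      (- 1) ^ card (?V - X)) = (\<Sum>X\<in>prunings T. (- 1) ^ ?N * (q_var ^ card X * G_series m (subtree_at T X)))"
  proof (rule sum.cong)
    fix X assume X: "X \<in> prunings T"
    have "?N = card X + card (?V - X)"
      using prunings_subset[OF X] t'(1) by (simp add: N card_Diff_subset finite_subset card_mono)
    moreover have "(- q_var) ^ card X = (- 1) ^ card X * q_var ^ card X"
      by (simp flip: power_mult_distrib)
    ultimately show "(- q_var) ^ tree_size (subtree_at T X) * G_series m (subtree_at T X) *
        (- 1) ^ card (?V - X) = (- 1) ^ ?N * (q_var ^ card X * G_series m (subtree_at T X))"
      by (simp add: tree_size_subtree_at[OF X] power_add)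
  qed simp
  also have "\<dots> = (- 1) ^ ?N * ?Q" by (simp add: sum_distrib_left)
  finally have Q: "(\<Sum>X\<in>prunings T. (- q_var) ^ tree_size (subtree_at T X) *
      G_series m (subtree_at T X) * (- 1) ^ card (?V - X)) = (- 1) ^ ?N * ?Q" .
  \<comment> \<open>The root lies in no branch, so the signs of the branches multiply to
    \<open>(- 1) ^ (?N - 1)\<close>; this off-by-one produces the minus sign in
    \<open>P\<close>.\<close>
  have "?N = Suc (card (?V - {root ?t}))"
    unfolding N using t'(1,2) by (rule card.remove)
  also have "card (?V - {root ?t}) = (\<Sum>C\<in>branches T. card C)"
  proof -
    have "card (\<Union>(branches T)) = (\<Sum>C\<in>branches T. card C)"
    proof (rule card_Union_disjoint)
      show "pairwise disjnt (branches T)"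
        using components_disjoint[OF t'(4)] by (auto simp: pairwise_def disjnt_def)
      show "finite C" if "C \<in> branches T" for C
        using components_subset[OF that] t'(1) by (auto intro: finite_subset)
    qed
    then show ?thesis by (simp add: components_Union)
  qed
  finally have N_branches: "?N = Suc (\<Sum>C\<in>branches T. card C)" .
  have "(\<Prod>C\<in>branches T. (1 / q_var) ^ card C *
      ((- q_var) ^ tree_size (component_tree T C) * G_series m (component_tree T C))) =
    (\<Prod>C\<in>branches T. (- 1) ^ card C * G_series m (component_tree T C))"
    by (intro prod.cong refl) (simp only: tree_size_component_tree cancel)
  also have "\<dots> = (- 1) ^ (\<Sum>C\<in>branches T. card C) * ?P"
    by (simp add: prod.distrib power_sum)
  also have "\<dots> = - ((- 1) ^ ?N * ?P)" by (simp add: N_branches)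
  finally have P: "(\<Prod>C\<in>branches T. (1 / q_var) ^ card C *
      ((- q_var) ^ tree_size (component_tree T C) * G_series m (component_tree T C))) =
    - ((- 1) ^ ?N * ?P)" .
  \<comment> \<open>On the one-vertex tree \<open>?N\<close> is 1; on all others both sides
    vanish.\<close>
  have b: "(- 1) ^ ?N * bullet_series T = - bullet_series T"
    using abs_tree_eq_bullet_iff[OF t] by (simp add: bullet_series_def abs_rep_tree N)
  have "G_series m T - ?Q = bullet_series T - q_var ^ Suc m * ?P"
    using key by (simp add: algebra_simps)
  then have "(- 1) ^ ?N * (G_series m T - ?Q) = (- 1) ^ ?N * (bullet_series T - q_var ^ Suc m * ?P)"
    by (rule arg_cong)
  then show "(1 / q_var) ^ ?N * ((- q_var) ^ ?N * G_series m T) -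
      (\<Sum>X\<in>prunings T. (- q_var) ^ tree_size (subtree_at T X) *
        G_series m (subtree_at T X) * (- 1) ^ card (?V - X)) =
    q_var ^ Suc m * (\<Prod>C\<in>branches T. (1 / q_var) ^ card C *
      ((- q_var) ^ tree_size (component_tree T C) * G_series m (component_tree T C))) -
    bullet_series T"
    unfolding P Q cancel by (simp add: right_diff_distrib b mult.left_commute)
qed

section \<open>Substitution of \<open>1 / q\<close> for \<open>q\<close>\<close>

lemma eval_q_0 [simp]: "eval_q 0 y = 0"
  by (simp add: eval_q_def)

lemma eval_q_pCons: "eval_q (pCons a p) y = to_fract [:a:] + y * eval_q p y"
  by (simp add: eval_q_def map_poly_pCons)

lemma eval_q_add: "eval_q (p + r) y = eval_q p y + eval_q r y"
proof (induction p r rule: poly_induct2)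
  case (pCons a p b r)
  have "to_fract [:a + b:] = to_fract [:a:] + to_fract [:b:]"
    by (simp flip: to_fract_add)
  then show ?case using pCons by (simp add: eval_q_pCons algebra_simps)
qed simp

lemma eval_q_smult: "eval_q (smult a p) y = to_fract [:a:] * eval_q p y"
proof (induction p)
  case (pCons b p)
  have "to_fract [:a * b:] = to_fract [:a:] * to_fract [:b:]"
    by (simp flip: to_fract_mult)
  then show ?case using pCons by (simp add: eval_q_pCons algebra_simps)
qed simp

lemma eval_q_mult: "eval_q (p * r) y = eval_q p y * eval_q r y"
  by (induction p) (simp_all add: eval_q_add eval_q_smult eval_q_pCons algebra_simps)

lemma eval_q_1: "eval_q 1 y = 1"
  using eval_q_pCons[of 1 0 y] by (simp flip: one_pCons)

lemma eval_q_at_q: "eval_q p q_var = to_fract p"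
proof (induction p)
  case (pCons a p)
  have "to_fract (pCons a p) = to_fract ([:a:] + [:0, 1:] * p)" by simp
  also have "\<dots> = to_fract [:a:] + q_var * to_fract p"
    by (simp only: to_fract_add to_fract_mult q_var_def)
  finally show ?case using pCons by (simp add: eval_q_pCons)
qed simp

lemma q_var_power_neq_1:
  assumes "k > 0"
  shows "q_var ^ k \<noteq> 1"
proof
  assume "q_var ^ k = 1"
  moreover have "to_fract ([:0, 1:] ^ k :: rat poly) = q_var ^ k"
    unfolding q_var_def by (induction k) (simp_all only: power_0 power_Suc to_fract_mult to_fract_1)
  ultimately have "to_fract ([:0, 1:] ^ k :: rat poly) = to_fract 1" by simp
  then have "[:0, 1:] ^ k = (1 :: rat poly)" by (simp only: to_fract_eq_iff)
  then have "degree ([:0, 1:] ^ k :: rat poly) = 0" by simp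
  then show False using assms by (simp add: degree_power_eq)
qed

text \<open>Multiplied by q^(deg p), the value of p at 1/q is the polynomial with reversed
  coefficients, which is nonzero with p.\<close>

lemma eval_q_inverse_nonzero:
  assumes "p \<noteq> 0"
  shows "eval_q p (1 / q_var) \<noteq> 0"
proof -
  let ?f = "\<lambda>c::rat. to_fract [:c:]"
  have "degree (map_poly ?f p) = degree p" by (rule degree_map_poly) simp
  then have "reflect_poly (map_poly ?f p) = map_poly ?f (reflect_poly p)"
    by (intro poly_eqI) (simp add: coeff_reflect_poly coeff_map_poly)
  then have "to_fract (reflect_poly p) = q_var ^ degree p * eval_q p (1 / q_var)"
    using poly_reflect_poly_nz[OF q_var_nonzero, of "map_poly ?f p"]
      \<open>degree (map_poly ?f p) = degree p\<close> eval_q_at_q[of "reflect_poly p"]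
    by (simp add: eval_q_def inverse_eq_divide)
  moreover have "to_fract (reflect_poly p) \<noteq> 0" using assms by simp
  ultimately show ?thesis by auto
qed

text \<open>\<open>subst_q\<close> uses the normalised fraction; cross-multiplication shows that any
  other fraction gives the same value, as no denominator vanishes at \<open>y\<close>. Sums and
  products, whose fractions need not be reduced, become accessible in this way.\<close>

lemma subst_q_Fract:
  assumes b: "b \<noteq> 0" and y: "\<And>p. p \<noteq> 0 \<Longrightarrow> eval_q p y \<noteq> 0"
  shows "subst_q y (Fract a b) = eval_q a y / eval_q b y"
proof -
  obtain c d where cd: "quot_of_fract (Fract a b) = (c, d)" by fastforce
  then have d: "d \<noteq> 0" using snd_quot_of_fract_nonzero[of "Fract a b"] by simp
  have "Fract c d = Fract a b" using Fract_quot_of_fract[of "Fract a b"] cd by simp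
  then have "eval_q (c * b) y = eval_q (a * d) y" using b d by (simp add: eq_fract)
  then show ?thesis using y[OF b] y[OF d]
    by (simp add: subst_q_def cd eval_q_mult frac_eq_eq)
qed

lemma ring_homomorphism_subst_q:
  assumes y: "\<And>p. p \<noteq> 0 \<Longrightarrow> eval_q p y \<noteq> 0"
  shows "ring_homomorphism (subst_q y)"
proof
  note s = subst_q_Fract[OF _ y]
  show "subst_q y (f + g) = subst_q y f + subst_q y g" for f g
    by (cases f; cases g) (simp add: s y eval_q_add eval_q_mult add_frac_eq mult.commute)
  show "subst_q y (f * g) = subst_q y f * subst_q y g" for f g
    by (cases f; cases g) (simp add: s y eval_q_mult)
  have "subst_q y 1 = subst_q y (Fract 1 1)" by (simp add: One_fract_def)
  then show "subst_q y 1 = 1" by (simp add: s eval_q_1)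
qed

lemma subst_q_q_var:
  assumes y: "\<And>p. p \<noteq> 0 \<Longrightarrow> eval_q p y \<noteq> 0"
  shows "subst_q y q_var = y"
proof -
  have "q_var = Fract [:0, 1:] 1" by (simp add: q_var_def to_fract_def)
  moreover have "to_fract [:1:] = (1 :: ratq)" by (simp flip: one_pCons)
  ultimately show ?thesis using subst_q_Fract[OF _ y, of 1 "[:0, 1:]"]
    by (simp add: eval_q_1 eval_q_pCons)
qed

section \<open>The series S and its specialisation\<close>

lemma S_equation_iff_crl_equation:
  "S_equation S \<longleftrightarrow> crl_equation [:q_var:] ([:q_var:] * (1 + ([:q_var:] - 1) * [:0, 1:])) S"
  by (simp only: S_equation_def crl_equation_def Let_def fun_eq_iff)

lemma const_power_minus_one: "[:q_var:] ^ k - 1 = [:q_var ^ k - 1:]"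
  by (simp add: one_pCons poly_const_pow)

text \<open>The definite description is justified by existence and uniqueness:
  \<open>[:q_var:] ^ k - 1\<close> is a nonzero constant polynomial over a field, hence
  invertible.\<close>

lemma S_equation_S_series: "S_equation S_series"
proof -
  have "([:q_var:] ^ k - 1) * [:inverse (q_var ^ k - 1):] = 1" if "k > 0" for k
    unfolding const_power_minus_one using q_var_power_neq_1[OF that] by (simp add: one_pCons)
  then obtain S where S: "S_equation S"
    using crl_equation_exists[of "[:q_var:]" "\<lambda>k. [:inverse (q_var ^ k - 1):]"]
    unfolding S_equation_iff_crl_equation by blast
  have "[:q_var:] ^ k \<noteq> 1" if "k > 0" for k
    using q_var_power_neq_1[OF that] by (simp add: poly_const_pow one_pCons)
  then have uniq: "S' = S" if "S_equation S'" for S'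
    using crl_equation_unique that S unfolding S_equation_iff_crl_equation by blast
  show ?thesis unfolding S_series_def by (rule theI[of S_equation, OF S uniq])
qed

theorem mainTheorem3:
  fixes n :: nat
  assumes "n \<ge> 2"
  shows "(\<lambda>T. subst_q (1 / q_var) (poly (S_series T) (q_int (- int n)))) =
         (\<lambda>T. - q_var * Sigma_series (- q_var) (G_series (n - 2)) T)"
proof -
  interpret sub: ring_homomorphism "subst_q (1 / q_var)"
    by (rule ring_homomorphism_subst_q) (rule eval_q_inverse_nonzero)
  let ?x = "q_int (- int n)"
  \<comment> \<open>The point [-n]_q is inserted before q is replaced, so the q inside [-n]_q is
    replaced too.\<close>
  let ?h = "\<lambda>p. subst_q (1 / q_var) (poly p ?x)"
  interpret h: ring_homomorphism ?h
    by unfold_locales (simp_all add: sub.hom_add sub.hom_mult sub.hom_1)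
  have q: "subst_q (1 / q_var) q_var = 1 / q_var"
    by (rule subst_q_q_var) (rule eval_q_inverse_nonzero)
  have "1 + (q_var - 1) * ?x = q_var powi (- int n)"
    using q_var_power_neq_1[of 1] by (simp add: q_int_def)
  then have "q_var ^ n * (1 + (q_var - 1) * ?x) = 1"
    using q_var_nonzero by (simp add: power_int_minus)
  then have "(1 / q_var) ^ n * subst_q (1 / q_var) (1 + (q_var - 1) * ?x) = 1"
    using sub.hom_mult sub.hom_power sub.hom_1 q by metis
  then have x: "subst_q (1 / q_var) (1 + (q_var - 1) * ?x) = q_var ^ n"
    using q_var_nonzero by (simp add: power_one_over divide_eq_eq)
  have n: "n = Suc (Suc (n - 2))" using assms by simp
  have "?h ([:q_var:] * (1 + ([:q_var:] - 1) * [:0, 1:])) =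
      subst_q (1 / q_var) (q_var * (1 + (q_var - 1) * ?x))"
    by (simp add: mult.commute)
  also have "\<dots> = 1 / q_var * q_var ^ n" by (simp only: sub.hom_mult q x)
  \<comment> \<open>The exponent n - 1 equals \<open>Suc (n - 2)\<close> because n is at least
    2.\<close>
  also have "\<dots> = q_var ^ Suc (n - 2)" using q_var_nonzero by (subst n) simp
  finally have b: "?h ([:q_var:] * (1 + ([:q_var:] - 1) * [:0, 1:])) = q_var ^ Suc (n - 2)" .
  have a: "?h [:q_var:] = 1 / q_var" by (simp add: q)
  have S: "crl_equation (1 / q_var) (q_var ^ Suc (n - 2)) (\<lambda>T. ?h (S_series T))"
    using h.crl_equation_hom[OF S_equation_S_series[unfolded S_equation_iff_crl_equation]]
    unfolding a b .
  have neq_1: "(1 / q_var) ^ k \<noteq> 1" if "k > 0" for k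
    using q_var_power_neq_1[OF that] by (simp add: power_one_over)
  show ?thesis
    \<comment> \<open>Both series solve the same equation over Q(q);
      \<open>times_Sigma_series\<close> with \<open>- q_var\<close> gives the right-hand side its
      stated form.\<close>
    using crl_equation_unique[OF neq_1 S crl_equation_G_series] by (simp only: times_Sigma_series)
qed

end
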